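(* Work in ZFC and consider set-theoretic rank potentialism $\mathcal{V}=\{V_\beta\mid\beta\in\mathrm{Ord}\}$. There are worlds $V_\beta$ with $$\mathrm{S4.3}=\mathrm{Val}_{\mathcal{V}}(V_\beta,\mathcal{L}^\Diamond_{\in,V_\beta})=\mathrm{Val}_{\mathcal{V}}(V_\beta,\mathcal{L}_\in).$$
   Context: $\mathcal{V}$ is the potentialist system whose worlds are the rank-initial segments $V_\beta$, with $V_\beta$ accessing $V_\delta$ iff $\beta\le\delta$; $\Diamond\varphi$ at $V_\beta$ means $\varphi$ holds at some $V_\delta$, $\delta\ge\beta$, and $\Box\varphi$ means at all such; quantifiers range over the current world. $\mathcal{L}_\in$ is the language of set theory, $\mathcal{L}_\in^\Diamond$ adds modal operators, a subscript $V_\beta$ means parameters from $V_\beta$ are allowed. $\mathrm{Val}_{\mathcal{V}}(W,\mathcal{L}')$ is the set of propositional modal formulas all of whose substitution instances by $\mathcal{L}'$-sentences (propositional variables replaced by sentences) are true at $W$. *)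

theory Defs
  imports Main
begin

section \<open>Propositional modal logic and S4.3\<close>

datatype pmf = PVar nat | PBot | PImp pmf pmf | PBox pmf

abbreviation PNeg :: "pmf \<Rightarrow> pmf" where
  "PNeg p \<equiv> PImp p PBot"

abbreviation POr :: "pmf \<Rightarrow> pmf \<Rightarrow> pmf" where
  "POr p q \<equiv> PImp (PNeg p) q"

abbreviation PAnd :: "pmf \<Rightarrow> pmf \<Rightarrow> pmf" where
  "PAnd p q \<equiv> PNeg (PImp p (PNeg q))"

abbreviation PDia :: "pmf \<Rightarrow> pmf" where
  "PDia p \<equiv> PNeg (PBox (PNeg p))"

text \<open>The first three axiom schemes, with modus ponens, generate exactly the classical
  tautologies over implication and falsum. Since the axioms are schemes, the set is closed
  under uniform substitution.\<close>

inductive_set S43 :: "pmf set" where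
  prop_K: "PImp p (PImp q p) \<in> S43"
| prop_S: "PImp (PImp p (PImp q r)) (PImp (PImp p q) (PImp p r)) \<in> S43"
| prop_DN: "PImp (PNeg (PNeg p)) p \<in> S43"
| ax_K: "PImp (PBox (PImp p q)) (PImp (PBox p) (PBox q)) \<in> S43"
| ax_T: "PImp (PBox p) p \<in> S43"
| ax_4: "PImp (PBox p) (PBox (PBox p)) \<in> S43"
| ax_3: "PImp (PAnd (PDia p) (PDia q))
           (PDia (POr (PAnd p (PDia q)) (PAnd q (PDia p)))) \<in> S43"
| MP: "PImp p q \<in> S43 \<Longrightarrow> p \<in> S43 \<Longrightarrow> q \<in> S43"
| Nec: "p \<in> S43 \<Longrightarrow> PBox p \<in> S43"


section \<open>The modal language of set theory with parameters\<close>

datatype (tparams: 'a) trm = Var nat | Par 'a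

text \<open>The set function \<open>params\<close> generated by the datatype package collects the
  parameters \<open>Par a\<close> occurring in a formula.\<close>

datatype (params: 'a) fml =
    Mem "'a trm" "'a trm"
  | Eql "'a trm" "'a trm"
  | Bot
  | Imp "'a fml" "'a fml"
  | Forall nat "'a fml"
  | Box "'a fml"

abbreviation Neg :: "'a fml \<Rightarrow> 'a fml" where
  "Neg \<phi> \<equiv> Imp \<phi> Bot"

abbreviation Dia :: "'a fml \<Rightarrow> 'a fml" where
  "Dia \<phi> \<equiv> Neg (Box (Neg \<phi>))"

primrec tvars :: "'a trm \<Rightarrow> nat set" where
  "tvars (Var n) = {n}"
| "tvars (Par a) = {}"

primrec fvars :: "'a fml \<Rightarrow> nat set" where
  "fvars (Mem t u) = tvars t \<union> tvars u"
| "fvars (Eql t u) = tvars t \<union> tvars u"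
| "fvars Bot = {}"
| "fvars (Imp \<phi> \<psi>) = fvars \<phi> \<union> fvars \<psi>"
| "fvars (Forall n \<phi>) = fvars \<phi> - {n}"
| "fvars (Box \<phi>) = fvars \<phi>"

primrec nonmodal :: "'a fml \<Rightarrow> bool" where
  "nonmodal (Mem t u) = True"
| "nonmodal (Eql t u) = True"
| "nonmodal Bot = True"
| "nonmodal (Imp \<phi> \<psi>) = (nonmodal \<phi> \<and> nonmodal \<psi>)"
| "nonmodal (Forall n \<phi>) = nonmodal \<phi>"
| "nonmodal (Box \<phi>) = False"

text \<open>\<open>E\<close> is the membership relation of the ambient universe, \<open>D w\<close> the domain of
  world \<open>w\<close>, and \<open>R\<close> the accessibility relation.\<close>

primrec tval :: "(nat \<Rightarrow> 'a) \<Rightarrow> 'a trm \<Rightarrow> 'a" where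
  "tval s (Var n) = s n"
| "tval s (Par a) = a"

primrec sat :: "('a \<Rightarrow> 'a \<Rightarrow> bool) \<Rightarrow> ('w \<Rightarrow> 'a set) \<Rightarrow> ('w \<Rightarrow> 'w \<Rightarrow> bool)
    \<Rightarrow> 'w \<Rightarrow> (nat \<Rightarrow> 'a) \<Rightarrow> 'a fml \<Rightarrow> bool" where
  "sat E D R w s (Mem t u) = E (tval s t) (tval s u)"
| "sat E D R w s (Eql t u) = (tval s t = tval s u)"
| "sat E D R w s Bot = False"
| "sat E D R w s (Imp \<phi> \<psi>) = (sat E D R w s \<phi> \<longrightarrow> sat E D R w s \<psi>)"
| "sat E D R w s (Forall n \<phi>) = (\<forall>x\<in>D w. sat E D R w (s(n := x)) \<phi>)"
| "sat E D R w s (Box \<phi>) = (\<forall>v. R w v \<longrightarrow> sat E D R v s \<phi>)"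

lemma sat_Dia: "sat E D R w s (Dia \<phi>) \<longleftrightarrow> (\<exists>v. R w v \<and> sat E D R v s \<phi>)"
  by simp

primrec inst :: "(nat \<Rightarrow> 'a fml) \<Rightarrow> pmf \<Rightarrow> 'a fml" where
  "inst \<sigma> (PVar n) = \<sigma> n"
| "inst \<sigma> PBot = Bot"
| "inst \<sigma> (PImp p q) = Imp (inst \<sigma> p) (inst \<sigma> q)"
| "inst \<sigma> (PBox p) = Box (inst \<sigma> p)"

text \<open>Substitution instances by sentences are sentences, so the assignment \<open>s\<close> below is
  immaterial; it takes values in the whole type because a world may have empty domain.\<close>

definition Val :: "('a \<Rightarrow> 'a \<Rightarrow> bool) \<Rightarrow> ('w \<Rightarrow> 'a set) \<Rightarrow> ('w \<Rightarrow> 'w \<Rightarrow> bool)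
    \<Rightarrow> 'w \<Rightarrow> 'a fml set \<Rightarrow> pmf set" where
  "Val E D R w L = {p. \<forall>\<sigma>. (\<forall>n. \<sigma> n \<in> L) \<longrightarrow> (\<forall>s. sat E D R w s (inst \<sigma> p))}"

definition L_set :: "'a fml set" where
  "L_set = {\<phi>. fvars \<phi> = {} \<and> nonmodal \<phi> \<and> params \<phi> = {}}"

definition L_set_dia :: "'a set \<Rightarrow> 'a fml set" where
  "L_set_dia A = {\<phi>. fvars \<phi> = {} \<and> params \<phi> \<subseteq> A}"


section \<open>Models of ZFC\<close>

text \<open>Satisfaction in the whole universe; only meaningful for nonmodal formulas.\<close>

definition fo_sat :: "('a \<Rightarrow> 'a \<Rightarrow> bool) \<Rightarrow> (nat \<Rightarrow> 'a) \<Rightarrow> 'a fml \<Rightarrow> bool" where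
  "fo_sat E s \<phi> = sat E (\<lambda>_. UNIV) (\<lambda>_ _. False) () s \<phi>"

text \<open>First-order ZFC: the model need not be well-founded or a standard model, and the two
  schemes range over formulas of the language of set theory. Variables other than the
  designated ones serve as parameters, through the assignment \<open>s\<close>.\<close>

locale ZFC =
  fixes E :: "'a \<Rightarrow> 'a \<Rightarrow> bool"
  assumes extensionality: "(\<And>x. E x a \<longleftrightarrow> E x b) \<Longrightarrow> a = b"
    and foundation: "E x a \<Longrightarrow> \<exists>y. E y a \<and> \<not> (\<exists>z. E z y \<and> E z a)"
    and pairing: "\<exists>c. \<forall>x. E x c \<longleftrightarrow> x = a \<or> x = b"
    and union: "\<exists>b. \<forall>x. E x b \<longleftrightarrow> (\<exists>y. E x y \<and> E y a)"
    and powerset: "\<exists>b. \<forall>x. E x b \<longleftrightarrow> (\<forall>y. E y x \<longrightarrow> E y a)"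
    and infinity: "\<exists>a. (\<exists>e. E e a \<and> (\<forall>x. \<not> E x e)) \<and>
        (\<forall>x. E x a \<longrightarrow> (\<exists>y. E y a \<and> (\<forall>z. E z y \<longleftrightarrow> E z x \<or> z = x)))"
    and separation: "nonmodal \<phi> \<Longrightarrow> params \<phi> = {} \<Longrightarrow>
        \<exists>b. \<forall>x. E x b \<longleftrightarrow> E x a \<and> fo_sat E (s(0 := x)) \<phi>"
    and replacement: "nonmodal \<phi> \<Longrightarrow> params \<phi> = {} \<Longrightarrow>
        (\<And>x. E x a \<Longrightarrow> \<exists>!y. fo_sat E (s(0 := x, 1 := y)) \<phi>) \<Longrightarrow>
        \<exists>b. \<forall>y. E y b \<longleftrightarrow> (\<exists>x. E x a \<and> fo_sat E (s(0 := x, 1 := y)) \<phi>)"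
    and choice: "(\<And>x. E x a \<Longrightarrow> \<exists>y. E y x) \<Longrightarrow>
        (\<And>x y z. E x a \<Longrightarrow> E y a \<Longrightarrow> E z x \<Longrightarrow> E z y \<Longrightarrow> x = y) \<Longrightarrow>
        \<exists>c. \<forall>x. E x a \<longrightarrow> (\<exists>!y. E y x \<and> E y c)"


section \<open>Rank potentialism\<close>

definition is_trans :: "('a \<Rightarrow> 'a \<Rightarrow> bool) \<Rightarrow> 'a \<Rightarrow> bool" where
  "is_trans E a \<longleftrightarrow> (\<forall>x y. E x y \<and> E y a \<longrightarrow> E x a)"

definition is_Ord :: "('a \<Rightarrow> 'a \<Rightarrow> bool) \<Rightarrow> 'a \<Rightarrow> bool" where
  "is_Ord E \<beta> \<longleftrightarrow> is_trans E \<beta> \<and> (\<forall>x. E x \<beta> \<longrightarrow> is_trans E x)"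

definition is_upair :: "('a \<Rightarrow> 'a \<Rightarrow> bool) \<Rightarrow> 'a \<Rightarrow> 'a \<Rightarrow> 'a \<Rightarrow> bool" where
  "is_upair E a b p \<longleftrightarrow> (\<forall>x. E x p \<longleftrightarrow> x = a \<or> x = b)"

definition is_opair :: "('a \<Rightarrow> 'a \<Rightarrow> bool) \<Rightarrow> 'a \<Rightarrow> 'a \<Rightarrow> 'a \<Rightarrow> bool" where
  "is_opair E a b p \<longleftrightarrow> (\<exists>u v. is_upair E a a u \<and> is_upair E a b v \<and> is_upair E u v p)"

definition maps_to :: "('a \<Rightarrow> 'a \<Rightarrow> bool) \<Rightarrow> 'a \<Rightarrow> 'a \<Rightarrow> 'a \<Rightarrow> bool" where
  "maps_to E f x y \<longleftrightarrow> (\<exists>p. E p f \<and> is_opair E x y p)"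

text \<open>\<open>f\<close> is, inside the model, the sequence of all \<open>V\<^sub>\<alpha>\<close> with \<open>\<alpha> \<le> \<beta>\<close>, where
  \<open>V\<^sub>\<alpha>\<close> is the union of the power sets of the \<open>V\<^sub>\<gamma>\<close> with \<open>\<gamma> < \<alpha>\<close>. The recursion has to
  be witnessed by an element of the model, as the model may be ill-founded.\<close>

definition rank_seq :: "('a \<Rightarrow> 'a \<Rightarrow> bool) \<Rightarrow> 'a \<Rightarrow> 'a \<Rightarrow> bool" where
  "rank_seq E \<beta> f \<longleftrightarrow>
    (\<forall>\<alpha>. E \<alpha> \<beta> \<or> \<alpha> = \<beta> \<longrightarrow>
      (\<exists>!v. maps_to E f \<alpha> v) \<and>
      (\<forall>v. maps_to E f \<alpha> v \<longrightarrow>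
        (\<forall>x. E x v \<longleftrightarrow> (\<exists>\<gamma> w. E \<gamma> \<alpha> \<and> maps_to E f \<gamma> w \<and> (\<forall>y. E y x \<longrightarrow> E y w)))))"

definition Vseg :: "('a \<Rightarrow> 'a \<Rightarrow> bool) \<Rightarrow> 'a \<Rightarrow> 'a set" where
  "Vseg E \<beta> = {x. \<exists>f v. rank_seq E \<beta> f \<and> maps_to E f \<beta> v \<and> E x v}"

text \<open>The world \<open>V\<^sub>\<beta>\<close> is represented by its index, the ordinal \<open>\<beta>\<close> of the model.\<close>

definition ord_le :: "('a \<Rightarrow> 'a \<Rightarrow> bool) \<Rightarrow> 'a \<Rightarrow> 'a \<Rightarrow> bool" where
  "ord_le E \<beta> \<delta> \<longleftrightarrow> is_Ord E \<beta> \<and> is_Ord E \<delta> \<and> (E \<beta> \<delta> \<or> \<beta> = \<delta>)"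

abbreviation Val_rank :: "('a \<Rightarrow> 'a \<Rightarrow> bool) \<Rightarrow> 'a \<Rightarrow> 'a fml set \<Rightarrow> pmf set" where
  "Val_rank E \<equiv> Val E (Vseg E) (ord_le E)"

end

theory Submission
  imports Defs
begin

text \<open>
  Soundness holds because the ordinals of the model are linearly ordered. For the converse take
  \<open>\<beta> = 0\<close>. A formula outside S4.3 fails at the root of a finite chain of clusters, which may be taken
  to be \<open>{0..n} \<times> {0..N}\<close> preordered by the first coordinate. Every ordinal \<open>\<delta>\<close> is sent to the pair
  consisting of the number of limits of limits \<open>\<le> \<delta>\<close>, capped at \<open>n\<close>, and of the \<open>j\<close> with
  \<open>\<delta> = \<lambda> + j\<close>, \<open>\<lambda>\<close> zero or a limit, capped at \<open>N\<close>. Since limits are cofinal below each limit of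
  limits and limits of limits are cofinal in the ordinals, this is a bounded morphism. Both
  coordinates are read off in \<open>V\<^sub>\<delta>\<close> by parameter-free first-order sentences, since the ordinals
  of \<open>V\<^sub>\<delta>\<close> are the elements of \<open>\<delta>\<close>. The model may be ill-founded, so all recursions and
  inductions on its ordinals go through definable predicates.
\<close>

section \<open>Kripke semantics\<close>

text \<open>No two distinct ordinals see each other, yet the points of a cluster must; so every
  label has to recur above every point of its stage. This is why stages are separated by limits of
  limits and not by limits: between successive limits the second coordinate can only grow, and only
  a further limit inside the same stage resets it to 0. The caps make the finite frame exhaustive:
  the last stage takes in all later ordinals, the last value of the second coordinate all other
  \<lambda> + j, even for nonstandard j. They also leave only finitely many labels, so that any
  valuation of the frame becomes a finite disjunction of sentences. The choice \<beta> = 0 puts the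
  world at the root: no limit of limits is passed and the offset is 0.\<close>

primrec holds :: "('w \<Rightarrow> 'w \<Rightarrow> bool) \<Rightarrow> ('w \<Rightarrow> nat \<Rightarrow> bool) \<Rightarrow> 'w \<Rightarrow> pmf \<Rightarrow> bool" where
  "holds R V w (PVar n) = V w n"
| "holds R V w PBot = False"
| "holds R V w (PImp p q) = (holds R V w p \<longrightarrow> holds R V w q)"
| "holds R V w (PBox p) = (\<forall>v. R w v \<longrightarrow> holds R V v p)"

text \<open>A box moves the world and keeps the assignment, so a substitution acts as a valuation on
  the frame of worlds.\<close>

lemma sat_inst: "sat E D R w s (inst \<sigma> p) = holds R (\<lambda>v n. sat E D R v s (\<sigma> n)) w p"
  by (induction p arbitrary: w) auto

text \<open>The carrier \<open>A\<close> singles out the genuine worlds: the types also contain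
  indices that are no ordinals and pairs outside the finite frame.\<close>

lemma holds_bounded_morphism:
  assumes "w \<in> A"
    and up: "\<And>w v. w \<in> A \<Longrightarrow> R w v \<Longrightarrow> v \<in> A"
    and forth: "\<And>w v. w \<in> A \<Longrightarrow> R w v \<Longrightarrow> R' (g w) (g v)"
    and backw: "\<And>w u. w \<in> A \<Longrightarrow> R' (g w) u \<Longrightarrow> \<exists>v. R w v \<and> g v = u"
    and val: "\<And>w n. w \<in> A \<Longrightarrow> V w n = V' (g w) n"
  shows "holds R V w p = holds R' V' (g w) p"
  using assms(1)
proof (induction p arbitrary: w)
  case (PBox p)
  show ?case
    using PBox.IH up forth backw PBox.prems by simp metis
qed (use val in auto)

lemma S43_sound:
  assumes "p \<in> S43" "w \<in> A"
    and up: "\<And>w v. w \<in> A \<Longrightarrow> R w v \<Longrightarrow> v \<in> A"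
    and refl: "\<And>w. w \<in> A \<Longrightarrow> R w w"
    and trans: "\<And>u v w. R u v \<Longrightarrow> R v w \<Longrightarrow> R u w"
    and linear: "\<And>v w. v \<in> A \<Longrightarrow> w \<in> A \<Longrightarrow> R v w \<or> R w v"
  shows "holds R V w p"
  using assms(1,2)
proof (induction arbitrary: w)
  case (ax_3 p q)
  \<comment> \<open>Of the two witnesses, the one that sees the other verifies the outer
    diamond.\<close>
  show ?case using up[OF ax_3] linear by simp blast
next
  case (ax_T p)
  then show ?case using refl by simp
next
  case (ax_4 p)
  then show ?case using trans by auto
next
  case (Nec p)
  then show ?case using up by auto
qed auto

section \<open>Completeness of S4.3\<close>

text \<open>Necessitation enters only through \<open>S43\<close> and never applies to hypotheses, so
  the deduction theorem holds in full.\<close>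

inductive_set Cl :: "pmf set \<Rightarrow> pmf set" for \<Gamma> where
  ax: "p \<in> S43 \<Longrightarrow> p \<in> Cl \<Gamma>"
| hyp: "p \<in> \<Gamma> \<Longrightarrow> p \<in> Cl \<Gamma>"
| mp: "PImp p q \<in> Cl \<Gamma> \<Longrightarrow> p \<in> Cl \<Gamma> \<Longrightarrow> q \<in> Cl \<Gamma>"

lemma Cl_weaken: "q \<in> Cl \<Gamma> \<Longrightarrow> PImp p q \<in> Cl \<Gamma>"
  by (meson Cl.mp Cl.ax S43.prop_K)

lemma Cl_imp_distrib: "PImp p (PImp q r) \<in> Cl \<Gamma> \<Longrightarrow> PImp p q \<in> Cl \<Gamma> \<Longrightarrow> PImp p r \<in> Cl \<Gamma>"
  by (meson Cl.mp Cl.ax S43.prop_S)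

lemma Cl_imp_refl: "PImp p p \<in> Cl \<Gamma>"
  by (meson Cl_imp_distrib Cl.ax S43.prop_K)

lemma Cl_deduction: "q \<in> Cl (insert p \<Gamma>) \<Longrightarrow> PImp p q \<in> Cl \<Gamma>"
proof (induction rule: Cl.induct)
  case (hyp q)
  then show ?case using Cl_imp_refl Cl_weaken Cl.hyp by auto
qed (auto intro: Cl_weaken Cl.ax Cl_imp_distrib)

lemma Cl_mono: "q \<in> Cl \<Gamma> \<Longrightarrow> \<Gamma> \<subseteq> \<Delta> \<Longrightarrow> q \<in> Cl \<Delta>"
  by (induction rule: Cl.induct) (auto intro: Cl.intros)

text \<open>Axiom K carries the box through each modus ponens; theorems are boxed by
  necessitation.\<close>

lemma Cl_Box: "q \<in> Cl {p. PBox p \<in> \<Gamma>} \<Longrightarrow> PBox q \<in> Cl \<Gamma>"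
proof (induction rule: Cl.induct)
  case (mp p q)
  then show ?case by (meson Cl.mp Cl.ax S43.ax_K)
qed (auto intro: Cl.intros S43.Nec)

lemma Cl_empty: "Cl {} = S43"
proof
  show "Cl {} \<subseteq> S43"
  proof
    fix q assume "q \<in> Cl {}"
    then show "q \<in> S43" by (induction rule: Cl.induct) (auto intro: S43.MP)
  qed
qed (auto intro: Cl.ax)

text \<open>At each modus ponens the larger of the two sets serves both premises. This gives the
  upper bounds for Zorn's lemma.\<close>

lemma Cl_chain:
  assumes "q \<in> Cl (\<Union>C)" "subset.chain UNIV C" "C \<noteq> {}"
  shows "\<exists>\<Gamma>\<in>C. q \<in> Cl \<Gamma>"
  using assms(1)
proof (induction rule: Cl.induct)
  case (mp p q)
  then obtain \<Gamma> \<Delta> where *: "\<Gamma> \<in> C" "PImp p q \<in> Cl \<Gamma>" "\<Delta> \<in> C" "p \<in> Cl \<Delta>" by blast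
  then have "\<Gamma> \<subseteq> \<Delta> \<or> \<Delta> \<subseteq> \<Gamma>"
    using assms(2) by (auto simp: subset.chain_def)
  then show ?case using * by (meson Cl.mp Cl_mono)
qed (use assms(3) in \<open>auto intro: Cl.intros\<close>)

section \<open>Maximal consistent sets\<close>

definition mcs :: "pmf set \<Rightarrow> bool" where
  "mcs x \<longleftrightarrow> PBot \<notin> Cl x \<and> (\<forall>p. p \<notin> x \<longrightarrow> PBot \<in> Cl (insert p x))"

lemma lindenbaum:
  assumes "q \<notin> Cl \<Gamma>"
  shows "\<exists>x. mcs x \<and> \<Gamma> \<subseteq> x \<and> q \<notin> x"
proof -
  \<comment> \<open>If adding the negation of q were inconsistent, the deduction theorem and double
    negation would derive q.\<close>
  have c: "PBot \<notin> Cl (insert (PNeg q) \<Gamma>)"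
    using assms by (meson Cl.mp Cl.ax Cl_deduction S43.prop_DN)
  let ?A = "{x. PBot \<notin> Cl x \<and> insert (PNeg q) \<Gamma> \<subseteq> x}"
  obtain x where xA: "x \<in> ?A" and max: "\<forall>X\<in>?A. x \<subseteq> X \<longrightarrow> X = x"
  proof (rule bexE)
    show "\<exists>M\<in>?A. \<forall>X\<in>?A. M \<subseteq> X \<longrightarrow> X = M"
    proof (rule subset_Zorn_nonempty)
      show "?A \<noteq> {}" using c by blast
    next
      fix C assume C: "C \<noteq> {}" "subset.chain ?A C"
      then have "subset.chain UNIV C" by (auto simp: subset.chain_def)
      moreover have CA: "C \<subseteq> ?A" using C(2) by (simp add: subset.chain_def)
      ultimately have "PBot \<notin> Cl (\<Union>C)" using Cl_chain C(1) by blast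
      moreover have "insert (PNeg q) \<Gamma> \<subseteq> \<Union>C" using C(1) CA by blast
      ultimately show "\<Union>C \<in> ?A" by blast
    qed
  qed
  then have x: "PBot \<notin> Cl x" "insert (PNeg q) \<Gamma> \<subseteq> x" by simp_all
  have "mcs x"
    unfolding mcs_def
  proof (intro conjI allI impI x(1))
    fix p assume p: "p \<notin> x"
    show "PBot \<in> Cl (insert p x)"
    proof (rule ccontr)
      assume "PBot \<notin> Cl (insert p x)"
      then have "insert p x \<in> ?A" using x(2) by auto
      then have "insert p x = x" using max[rule_format, of "insert p x"] by blast
      then show False using p by auto
    qed
  qed
  moreover have "q \<notin> x"
  proof
    assume "q \<in> x"
    moreover have "PNeg q \<in> x" using x(2) by simp
    ultimately show False using x(1) Cl.mp[OF Cl.hyp Cl.hyp] by metis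
  qed
  ultimately show ?thesis using x(2) by auto
qed

context
  fixes x assumes mcs: "mcs x"
begin

lemma mcs_Cl: "p \<in> Cl x \<longleftrightarrow> p \<in> x"
  using mcs unfolding mcs_def by (meson Cl.hyp Cl.mp Cl_deduction)

lemma mcs_S43: "p \<in> S43 \<Longrightarrow> p \<in> x"
  using mcs_Cl Cl.ax by blast

lemma mcs_Bot: "PBot \<notin> x"
  using mcs by (auto simp: mcs_def intro: Cl.hyp)

lemma mcs_Imp: "PImp p q \<in> x \<longleftrightarrow> (p \<in> x \<longrightarrow> q \<in> x)"
proof
  assume "p \<in> x \<longrightarrow> q \<in> x"
  moreover have "PImp p q \<in> x" if "p \<notin> x"
  proof -
    have "PBot \<in> Cl (insert p x)" using mcs that by (auto simp: mcs_def)
    \<comment> \<open>Explosion: weakening falsum gives the double negation of q, hence q.\<close>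
    then have "PNeg q \<in> Cl (insert p x) \<and> PImp (PNeg q) PBot \<in> Cl (insert p x)"
      using Cl_weaken by blast
    then show ?thesis using mcs_Cl by (meson Cl.mp Cl.ax Cl_deduction S43.prop_DN)
  qed
  ultimately show "PImp p q \<in> x" using mcs_Cl Cl_weaken by blast
qed (use mcs_Cl Cl.mp in blast)

lemma mcs_T: "PBox p \<in> x \<Longrightarrow> p \<in> x"
  using mcs_S43[OF S43.ax_T] mcs_Imp by blast

lemma mcs_4: "PBox p \<in> x \<Longrightarrow> PBox (PBox p) \<in> x"
  using mcs_S43[OF S43.ax_4] mcs_Imp by blast

text \<open>If p followed from the formulas boxed in x, \<open>Cl_Box\<close> would put its box into
  x.\<close>

lemma mcs_Box_witness:
  assumes "PBox p \<notin> x"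
  shows "\<exists>y. mcs y \<and> {q. PBox q \<in> x} \<subseteq> y \<and> p \<notin> y"
  using assms Cl_Box mcs_Cl by (blast intro: lindenbaum)

end

lemmas mcs_simps = mcs_Imp mcs_Bot

lemma mcs_Dia_witness:
  assumes "mcs x" "PDia p \<in> x"
  shows "\<exists>y. mcs y \<and> {q. PBox q \<in> x} \<subseteq> y \<and> p \<in> y"
proof -
  have "PBox (PNeg p) \<notin> x" using assms by (simp add: mcs_simps)
  then obtain y where "mcs y" "{q. PBox q \<in> x} \<subseteq> y" "PNeg p \<notin> y"
    using mcs_Box_witness assms(1) by blast
  then show ?thesis by (auto simp: mcs_simps)
qed

lemma mcs_connected:
  assumes "mcs x" "mcs y" "mcs z" "{q. PBox q \<in> x} \<subseteq> y" "{q. PBox q \<in> x} \<subseteq> z"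
  shows "{q. PBox q \<in> y} \<subseteq> z \<or> {q. PBox q \<in> z} \<subseteq> y"
proof (rule ccontr)
  assume "\<not> ?thesis"
  then obtain a b where ab: "PBox a \<in> y" "a \<notin> z" "PBox b \<in> z" "b \<notin> y" by blast
  \<comment> \<open>\<open>?p\<close> holds at y and \<open>?q\<close> at z, so axiom 3 yields a u
    that satisfies one of them and sees the other. But the boxed half of the first contradicts the
    negated half of the second.\<close>
  let ?p = "PAnd (PBox a) (PNeg b)" and ?q = "PAnd (PBox b) (PNeg a)"
  have "?p \<in> y" "?q \<in> z" using ab assms by (simp_all add: mcs_simps)
  then have "PDia ?p \<in> x" "PDia ?q \<in> x"
    using assms by (auto simp: mcs_simps)
  then have "PDia (POr (PAnd ?p (PDia ?q)) (PAnd ?q (PDia ?p))) \<in> x"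
    using mcs_S43[OF assms(1) S43.ax_3[of ?p ?q]] assms(1) by (simp add: mcs_simps)
  then obtain u where u: "mcs u" "POr (PAnd ?p (PDia ?q)) (PAnd ?q (PDia ?p)) \<in> u"
    using mcs_Dia_witness[OF assms(1)] by blast
  then have "(PBox a \<in> u \<and> PDia ?q \<in> u) \<or> (PBox b \<in> u \<and> PDia ?p \<in> u)"
    by (auto simp: mcs_simps)
  then show False
  proof (elim disjE conjE)
    assume a: "PBox a \<in> u" "PDia ?q \<in> u"
    then obtain v where "mcs v" "{q. PBox q \<in> u} \<subseteq> v" "?q \<in> v"
      using mcs_Dia_witness u(1) by blast
    with a show False by (auto simp: mcs_simps)
  next
    assume a: "PBox b \<in> u" "PDia ?p \<in> u"
    then obtain v where "mcs v" "{q. PBox q \<in> u} \<subseteq> v" "?p \<in> v"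
      using mcs_Dia_witness u(1) by blast
    with a show False by (auto simp: mcs_simps)
  qed
qed

section \<open>Filtration of the canonical model\<close>

primrec Sub :: "pmf \<Rightarrow> pmf set" where
  "Sub (PVar n) = {PVar n}"
| "Sub PBot = {PBot}"
| "Sub (PImp p q) = insert (PImp p q) (Sub p \<union> Sub q)"
| "Sub (PBox p) = insert (PBox p) (Sub p)"

lemma finite_Sub: "finite (Sub p)"
  by (induction p) auto

lemma Sub_refl: "p \<in> Sub p"
  by (cases p) auto

lemma Sub_trans: "q \<in> Sub p \<Longrightarrow> Sub q \<subseteq> Sub p"
  by (induction p) auto

text \<open>The canonical model is filtered through the subformulas of \<open>p\<close>. In a finite
  chain of sets of boxed formulas the cardinality is an order embedding; this is the rank \<open>r\<close>.\<close>

lemma S43_finite_countermodel: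
  assumes "p \<notin> S43"
  shows "\<exists>(W :: pmf set set) T0 r V. finite W \<and> T0 \<in> W \<and> (\<forall>T\<in>W. r T0 \<le> (r T :: nat)) \<and>
    \<not> holds (\<lambda>T T'. T' \<in> W \<and> r T \<le> r T') V T0 p"
proof -
  obtain x0 where x0: "mcs x0" "p \<notin> x0"
    using lindenbaum[of p "{}"] assms Cl_empty by blast
  \<comment> \<open>Only the successors of \<open>x0\<close> are kept, because axiom 3 makes the
    canonical relation connected on these.\<close>
  define U where "U = {y. mcs y \<and> {q. PBox q \<in> x0} \<subseteq> y}"
  define tr where "tr = (\<lambda>y. y \<inter> Sub p)"
  define W where "W = tr ` U"
  \<comment> \<open>Inclusion of the boxed parts is the transitive filtration of the canonical
    relation.\<close>
  define B where "B = (\<lambda>T. {q. PBox q \<in> T \<and> PBox q \<in> Sub p})"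
  define r where "r = (\<lambda>T. card (B T))"
  have U0: "x0 \<in> U" using x0 mcs_T by (auto simp: U_def)
  have step: "z \<in> U" if "y \<in> U" "mcs z" "{q. PBox q \<in> y} \<subseteq> z" for y z
    using that mcs_4[OF x0(1)] by (auto simp: U_def)
  have B_mono: "B (tr y) \<subseteq> B (tr z)" if "y \<in> U" "{q. PBox q \<in> y} \<subseteq> z" for y z
    using that mcs_4 by (auto simp: B_def tr_def U_def)
  have B_chain: "B T \<subseteq> B T' \<or> B T' \<subseteq> B T" if T: "T \<in> W" "T' \<in> W" for T T'
  proof -
    obtain y z where "y \<in> U" "z \<in> U" "T = tr y" "T' = tr z" using T by (auto simp: W_def)
    moreover from this have "{q. PBox q \<in> y} \<subseteq> z \<or> {q. PBox q \<in> z} \<subseteq> y"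
      using mcs_connected[OF x0(1)] by (simp add: U_def)
    ultimately show ?thesis using B_mono by blast
  qed
  have finB: "finite (B T)" for T
  proof -
    have "B T \<subseteq> PBox -` Sub p" by (auto simp: B_def)
    moreover have "finite (PBox -` Sub p)" by (rule finite_vimageI) (auto simp: finite_Sub inj_def)
    ultimately show ?thesis by (rule finite_subset)
  qed
  have r_le: "r T \<le> r T' \<longleftrightarrow> B T \<subseteq> B T'" if "T \<in> W" "T' \<in> W" for T T'
    using B_chain[OF that] finB by (metis card_mono card_seteq order_refl r_def)
  have truth: "holds (\<lambda>T T'. T' \<in> W \<and> r T \<le> r T') (\<lambda>T n. PVar n \<in> T) (tr y) q \<longleftrightarrow> q \<in> y"
    if "q \<in> Sub p" "y \<in> U" for q y
    using that
  proof (induction q arbitrary: y)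
    case (PVar n)
    then show ?case by (simp add: tr_def)
  next
    case PBot
    then show ?case using mcs_Bot by (auto simp: U_def)
  next
    case (PImp q1 q2)
    then have "q1 \<in> Sub p" "q2 \<in> Sub p" using Sub_trans[of "PImp q1 q2" p] Sub_refl by auto
    then show ?case using PImp mcs_Imp by (auto simp: U_def)
  next
    case (PBox q)
    then have q: "q \<in> Sub p" using Sub_trans[of "PBox q" p] Sub_refl by auto
    have yW: "tr y \<in> W" using PBox.prems by (auto simp: W_def)
    show ?case
    proof
      assume l: "holds (\<lambda>T T'. T' \<in> W \<and> r T \<le> r T') (\<lambda>T n. PVar n \<in> T) (tr y) (PBox q)"
      show "PBox q \<in> y"
      proof (rule ccontr)
        assume "PBox q \<notin> y"
        then obtain z where z: "mcs z" "{q. PBox q \<in> y} \<subseteq> z" "q \<notin> z"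
          using mcs_Box_witness[of y q] PBox.prems(2) unfolding U_def by blast
        then have zU: "z \<in> U" using step PBox.prems by blast
        then have zW: "tr z \<in> W" by (auto simp: W_def)
        then have "r (tr y) \<le> r (tr z)" using r_le yW B_mono PBox.prems z by blast
        then show False using l zW PBox.IH[OF q zU] z by auto
      qed
    next
      assume b: "PBox q \<in> y"
      show "holds (\<lambda>T T'. T' \<in> W \<and> r T \<le> r T') (\<lambda>T n. PVar n \<in> T) (tr y) (PBox q)"
        unfolding holds.simps
      proof (intro allI impI, elim conjE)
        fix T' assume T': "T' \<in> W" "r (tr y) \<le> r T'"
        then obtain z where z: "z \<in> U" "T' = tr z" by (auto simp: W_def)
        have "q \<in> B (tr y)" using b PBox.prems by (auto simp: B_def tr_def)
        then have "q \<in> B T'" using r_le yW T' by blast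
        then have "q \<in> z" using z mcs_T by (auto simp: B_def tr_def U_def)
        then show "holds (\<lambda>T T'. T' \<in> W \<and> r T \<le> r T') (\<lambda>T n. PVar n \<in> T) T' q"
          using PBox.IH[OF q z(1)] z(2) by simp
      qed
    qed
  qed
  have "finite W"
    by (rule finite_subset[of _ "Pow (Sub p)"]) (auto simp: W_def tr_def finite_Sub)
  moreover have "tr x0 \<in> W" using U0 by (auto simp: W_def)
  moreover have "\<forall>T\<in>W. r (tr x0) \<le> r T"
    using r_le B_mono U0 by (auto simp: W_def U_def)
  moreover have "\<not> holds (\<lambda>T T'. T' \<in> W \<and> r T \<le> r T') (\<lambda>T n. PVar n \<in> T) (tr x0) p"
    using truth[OF Sub_refl U0] x0 by simp
  ultimately show ?thesis by blast
qed

text \<open>Empty levels of the rank function are filled with copies of the cluster below, and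
  clusters are padded with copies of one of their points.\<close>

lemma S43_complete:
  assumes "p \<notin> S43"
  shows "\<exists>n N V. \<not> holds (\<lambda>(i, j) (i', j'). i \<le> i' \<and> i' \<le> n \<and> j' \<le> N) V (0::nat, 0::nat) p"
proof -
  obtain W T0 r V where W: "finite W" "T0 \<in> W" "\<And>T. T \<in> W \<Longrightarrow> r T0 \<le> (r T :: nat)"
    and ref: "\<not> holds (\<lambda>T T'. T' \<in> (W :: pmf set set) \<and> r T \<le> r T') V T0 p"
    using S43_finite_countermodel[OF assms] by blast
  obtain xs where xs: "set xs = W" using W(1) finite_list by blast
  define N where "N = length xs"
  define n where "n = Max (r ` W)"
  \<comment> \<open>\<open>T0\<close> comes first so that (0, 0) is mapped to it; the indices are
    then 0 to \<open>N\<close>.\<close>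
  define e where "e = (\<lambda>j. (T0 # xs) ! j)"
  have eW: "e j \<in> W" if "j \<le> N" for j
    using that xs W(2) by (cases j) (auto simp: e_def N_def)
  have e_surj: "\<exists>j\<le>N. e j = T" if T: "T \<in> W" for T
  proof -
    obtain j where "j < length xs" "xs ! j = T" using T xs by (metis in_set_conv_nth)
    then show ?thesis by (intro exI[of _ "Suc j"]) (auto simp: e_def N_def)
  qed
  \<comment> \<open>Levels are the rank values themselves, so gaps occur; level i takes the largest
    rank present up to i. The inner \<open>max\<close> covers the levels below the least
    rank.\<close>
  define \<rho> where "\<rho> = (\<lambda>i. Max {k \<in> r ` W. k \<le> max i (r T0)})"
  have fin: "finite {k \<in> r ` W. k \<le> max i (r T0)}" for i using W(1) by auto
  have ne: "r T0 \<in> {k \<in> r ` W. k \<le> max i (r T0)}" for i using W(2) by auto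
  have \<rho>_in: "\<rho> i \<in> {k \<in> r ` W. k \<le> max i (r T0)}" for i
    unfolding \<rho>_def using Max_in[OF fin[of i]] ne[of i] by blast
  have \<rho>_ge: "k \<le> \<rho> i" if "k \<in> r ` W" "k \<le> max i (r T0)" for i k
    unfolding \<rho>_def using Max_ge[OF fin] that by auto
  have \<rho>_mono: "\<rho> i \<le> \<rho> i'" if "i \<le> i'" for i i'
    using \<rho>_in[of i] that by (intro \<rho>_ge) auto
  have \<rho>0: "\<rho> 0 = r T0" using \<rho>_in[of 0] \<rho>_ge[of "r T0" 0] W(2) by auto
  define g where "g = (\<lambda>(i, j). if r (e j) = \<rho> i then e j else SOME T. T \<in> W \<and> r T = \<rho> i)"
  have g: "g (i, j) \<in> W \<and> r (g (i, j)) = \<rho> i" if "j \<le> N" for i j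
  proof -
    have "\<exists>T. T \<in> W \<and> r T = \<rho> i" using \<rho>_in[of i] by auto
    from someI_ex[OF this] show ?thesis using eW[OF that] by (auto simp: g_def)
  qed
  have "g (0, 0) = T0" using \<rho>0 by (simp add: g_def e_def)
  moreover have "holds (\<lambda>(i, j) (i', j'). i \<le> i' \<and> i' \<le> n \<and> j' \<le> N) (\<lambda>w. V (g w)) (0, 0) p
      = holds (\<lambda>T T'. T' \<in> W \<and> r T \<le> r T') V (g (0, 0)) p"
  proof (rule holds_bounded_morphism[where A = "{(i, j). i \<le> n \<and> j \<le> N}"], goal_cases)
    case (4 w u)
    obtain i j where w: "w = (i, j)" "i \<le> n" "j \<le> N" using 4 by auto
    have u: "u \<in> W" "\<rho> i \<le> r u" using 4 g w by auto
    obtain j' where j': "j' \<le> N" "e j' = u" using e_surj u by blast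
    \<comment> \<open>This level is not below i and still has rank value \<open>r u\<close>: if r u
      \<le> i, then \<rho> i \<le> r u forces equality.\<close>
    define i' where "i' = max i (r u)"
    have "r u \<le> n" unfolding n_def using W(1) u by auto
    moreover have "\<rho> i' = r u"
    proof (cases "r u \<le> i")
      case True
      then show ?thesis using u \<rho>_ge[of "r u" i] by (auto simp: i'_def max_def)
    next
      case False
      then have "i' = r u" by (simp add: i'_def)
      then show ?thesis using \<rho>_in[of i'] \<rho>_ge[of "r u" i'] u W(3)[OF u(1)] by (auto simp: max_def)
    qed
    then have "g (i', j') = u" using j' by (simp add: g_def)
    ultimately show ?case using w j' by (intro exI[of _ "(i', j')"]) (auto simp: i'_def)
  qed (use g \<rho>_mono in auto)
  ultimately show ?thesis using ref by metis
qed

text \<open>Turns a capped count into a Boolean combination of finitely many conditions, the form in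
  which it can be defined by a sentence.\<close>

lemma Least_capped:
  "(LEAST k. k = n \<or> A k) = i \<longleftrightarrow> i \<le> n \<and> (i = n \<or> A i) \<and> (\<forall>k<i. \<not> A (k::nat))"
proof
  assume i: "(LEAST k. k = n \<or> A k) = i"
  show "i \<le> n \<and> (i = n \<or> A i) \<and> (\<forall>k<i. \<not> A k)"
    using LeastI[of "\<lambda>k. k = n \<or> A k" n] Least_le[of "\<lambda>k. k = n \<or> A k" n]
      not_less_Least[of _ "\<lambda>k. k = n \<or> A k"] i by auto
next
  assume "i \<le> n \<and> (i = n \<or> A i) \<and> (\<forall>k<i. \<not> A k)"
  then show "(LEAST k. k = n \<or> A k) = i"
    by (intro Least_equality) (auto simp: not_less[symmetric])
qed

section \<open>Definability\<close>

lemma sat_cong: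
  "(\<And>n. n \<in> fvars \<phi> \<Longrightarrow> s n = s' n) \<Longrightarrow> sat E D R w s \<phi> = sat E D R w s' \<phi>"
proof (induction \<phi> arbitrary: s s' w)
  case (Mem t u)
  then show ?case by (cases t; cases u) auto
next
  case (Eql t u)
  then show ?case by (cases t; cases u) auto
next
  case (Imp \<phi> \<psi>)
  have "sat E D R w s \<phi> = sat E D R w s' \<phi>" "sat E D R w s \<psi> = sat E D R w s' \<psi>"
    using Imp.prems by (intro Imp.IH; simp)+
  then show ?case by simp
next
  case (Forall n \<phi>)
  have "sat E D R w (s(n := x)) \<phi> = sat E D R w (s'(n := x)) \<phi>" for x
    using Forall.prems by (intro Forall.IH) simp
  then show ?case by simp
next
  case (Box \<phi>)
  have "sat E D R v s \<phi> = sat E D R v s' \<phi>" for v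
    using Box.prems by (intro Box.IH) simp
  then show ?case by simp
qed simp

lemma finite_fvars: "finite (fvars \<phi>)"
proof (induction \<phi>)
  case (Mem t u)
  then show ?case by (cases t; cases u) auto
next
  case (Eql t u)
  then show ?case by (cases t; cases u) auto
qed auto

text \<open>Mediates between variables numbered by position and named variables of formulas. Bound
  variables are moved off the image of \<open>f\<close>, which avoids capture.\<close>

lemma rename_fml:
  fixes E :: "'a \<Rightarrow> 'a \<Rightarrow> bool" and D :: "'w \<Rightarrow> 'a set"
  assumes "nonmodal \<phi>" "params \<phi> = {}"
  shows "\<exists>\<psi>. nonmodal \<psi> \<and> params \<psi> = {} \<and> fvars \<psi> \<subseteq> f ` fvars \<phi> \<and>
    (\<forall>R w s. sat E D R w s \<psi> = sat E D R w (\<lambda>n. s (f n)) \<phi>)"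
  using assms
proof (induction \<phi> arbitrary: f)
  case (Mem t u)
  then obtain i j where "t = Var i" "u = Var j" by (cases t; cases u) auto
  then show ?case by (intro exI[of _ "Mem (Var (f i)) (Var (f j))"]) auto
next
  case (Eql t u)
  then obtain i j where "t = Var i" "u = Var j" by (cases t; cases u) auto
  then show ?case by (intro exI[of _ "Eql (Var (f i)) (Var (f j))"]) auto
next
  case Bot
  then show ?case by (intro exI[of _ Bot]) simp
next
  case (Imp \<phi>1 \<phi>2)
  obtain \<psi>1 where "nonmodal \<psi>1" "params \<psi>1 = {}" "fvars \<psi>1 \<subseteq> f ` fvars \<phi>1"
      "\<forall>R w s. sat E D R w s \<psi>1 = sat E D R w (\<lambda>n. s (f n)) \<phi>1"
    using Imp.IH(1)[of f] Imp.prems by auto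
  moreover obtain \<psi>2 where "nonmodal \<psi>2" "params \<psi>2 = {}" "fvars \<psi>2 \<subseteq> f ` fvars \<phi>2"
      "\<forall>R w s. sat E D R w s \<psi>2 = sat E D R w (\<lambda>n. s (f n)) \<phi>2"
    using Imp.IH(2)[of f] Imp.prems by auto
  ultimately show ?case by (intro exI[of _ "Imp \<psi>1 \<psi>2"]) auto
next
  case (Forall n \<phi>)
  obtain m where m: "m \<notin> f ` fvars \<phi>"
    using finite_fvars[of \<phi>] by (metis ex_new_if_finite finite_imageI infinite_UNIV_nat)
  obtain \<psi> where \<psi>: "nonmodal \<psi>" "params \<psi> = {}" "fvars \<psi> \<subseteq> f(n := m) ` fvars \<phi>"
      "\<forall>R w s. sat E D R w s \<psi> = sat E D R w (\<lambda>k. s ((f(n := m)) k)) \<phi>"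
    using Forall.IH[of "f(n := m)"] Forall.prems by auto
  have "sat E D R w s (Forall m \<psi>) = sat E D R w (\<lambda>n. s (f n)) (Forall n \<phi>)" for R w s
  proof -
    have "sat E D R w (\<lambda>k. (s(m := x)) ((f(n := m)) k)) \<phi>
        = sat E D R w ((\<lambda>n. s (f n))(n := x)) \<phi>" for x
      by (rule sat_cong) (use m in auto)
    then show ?thesis using \<psi>(4) by simp
  qed
  moreover have "fvars (Forall m \<psi>) \<subseteq> f ` fvars (Forall n \<phi>)" using \<psi>(3) by auto
  ultimately show ?case using \<psi>(1,2) by (intro exI[of _ "Forall m \<psi>"]) simp
next
  case (Box \<phi>)
  then show ?case by simp
qed

text \<open>Variables are de Bruijn indices, so that the closure rules are syntax-directed. Only
  assignments into the world count, which makes bounded quantifiers absolute for transitive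
  worlds.\<close>

definition defin :: "('a \<Rightarrow> 'a \<Rightarrow> bool) \<Rightarrow> ('w \<Rightarrow> 'a set) \<Rightarrow> 'w set \<Rightarrow> nat
    \<Rightarrow> ('w \<Rightarrow> (nat \<Rightarrow> 'a) \<Rightarrow> bool) \<Rightarrow> bool" where
  "defin E D W k P \<longleftrightarrow> (\<exists>\<phi>. nonmodal \<phi> \<and> params \<phi> = {} \<and> fvars \<phi> \<subseteq> {..<k} \<and>
    (\<forall>R. \<forall>w\<in>W. \<forall>s. (\<forall>i<k. s i \<in> D w) \<longrightarrow> sat E D R w s \<phi> = P w s))"

lemma defin_cong:
  "defin E D W k P \<Longrightarrow> (\<And>w s. w \<in> W \<Longrightarrow> (\<And>i. i < k \<Longrightarrow> s i \<in> D w) \<Longrightarrow> P w s = Q w s)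
    \<Longrightarrow> defin E D W k Q"
  unfolding defin_def by meson

lemma defin_Mem: "i < k \<Longrightarrow> j < k \<Longrightarrow> defin E D W k (\<lambda>w s. E (s i) (s j))"
  unfolding defin_def by (rule exI[of _ "Mem (Var i) (Var j)"]) simp

lemma defin_Eql: "i < k \<Longrightarrow> j < k \<Longrightarrow> defin E D W k (\<lambda>w s. s i = s j)"
  unfolding defin_def by (rule exI[of _ "Eql (Var i) (Var j)"]) simp

lemma defin_False: "defin E D W k (\<lambda>w s. False)"
  unfolding defin_def by (rule exI[of _ Bot]) simp

lemma defin_imp:
  assumes "defin E D W k P" "defin E D W k Q"
  shows "defin E D W k (\<lambda>w s. P w s \<longrightarrow> Q w s)"
proof -
  obtain \<phi> where \<phi>: "nonmodal \<phi>" "params \<phi> = {}" "fvars \<phi> \<subseteq> {..<k}"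
    "\<forall>R. \<forall>w\<in>W. \<forall>s. (\<forall>i<k. s i \<in> D w) \<longrightarrow> sat E D R w s \<phi> = P w s"
    using assms(1) unfolding defin_def by blast
  obtain \<psi> where \<psi>: "nonmodal \<psi>" "params \<psi> = {}" "fvars \<psi> \<subseteq> {..<k}"
    "\<forall>R. \<forall>w\<in>W. \<forall>s. (\<forall>i<k. s i \<in> D w) \<longrightarrow> sat E D R w s \<psi> = Q w s"
    using assms(2) unfolding defin_def by blast
  show ?thesis
    unfolding defin_def using \<phi> \<psi> by (intro exI[of _ "Imp \<phi> \<psi>"]) simp
qed

lemma defin_all:
  assumes "defin E D W (Suc k) (\<lambda>w s. Q w (s 0) (\<lambda>i. s (Suc i)))"
  shows "defin E D W k (\<lambda>w s. \<forall>x\<in>D w. Q w x s)"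
proof -
  obtain \<phi> where \<phi>: "nonmodal \<phi>" "params \<phi> = {}" "fvars \<phi> \<subseteq> {..<Suc k}"
    and sat: "\<And>R w s. w \<in> W \<Longrightarrow> (\<And>i. i < Suc k \<Longrightarrow> s i \<in> D w) \<Longrightarrow>
      sat E D R w s \<phi> = Q w (s 0) (\<lambda>i. s (Suc i))"
    using assms unfolding defin_def by blast
  \<comment> \<open>The quantified position 0 gets the name \<open>k\<close>, the first outside the
    free variables; the other positions are shifted back.\<close>
  define g where "g = (\<lambda>n. case n of 0 \<Rightarrow> k | Suc i \<Rightarrow> i)"
  obtain \<psi> where \<psi>: "nonmodal \<psi>" "params \<psi> = {}" "fvars \<psi> \<subseteq> g ` fvars \<phi>"
      "\<forall>R w s. sat E D R w s \<psi> = sat E D R w (\<lambda>n. s (g n)) \<phi>"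
    using rename_fml[where E = E and D = D and f = g, OF \<phi>(1,2)] by blast
  have "fvars \<psi> \<subseteq> {..<Suc k}"
    using \<psi>(3) \<phi>(3) by (fastforce simp: g_def split: nat.splits)
  then have "fvars (Forall k \<psi>) \<subseteq> {..<k}" by auto
  moreover have "sat E D R w s (Forall k \<psi>) = (\<forall>x\<in>D w. Q w x s)"
    if w: "w \<in> W" and s: "\<forall>i<k. s i \<in> D w" for R w s
  proof -
    have "sat E D R w (s(k := x)) \<psi> = Q w x s" if x: "x \<in> D w" for x
    proof -
      have "sat E D R w (s(k := x)) \<psi> = sat E D R w (\<lambda>n. (s(k := x)) (g n)) \<phi>"
        using \<psi>(4) by blast
      also have "\<dots> = sat E D R w (case_nat x s) \<phi>"
        by (rule sat_cong) (use \<phi>(3) in \<open>auto simp: g_def split: nat.splits\<close>)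
      also have "\<dots> = Q w x s"
        using sat[OF w, of "case_nat x s"] s x by (auto split: nat.splits)
      finally show ?thesis .
    qed
    then show ?thesis by simp
  qed
  ultimately show ?thesis
    unfolding defin_def using \<psi>(1,2) by (intro exI[of _ "Forall k \<psi>"]) (auto simp del: sat.simps)
qed

lemma defin_not: "defin E D W k P \<Longrightarrow> defin E D W k (\<lambda>w s. \<not> P w s)"
  using defin_imp[OF _ defin_False, of E D W k P] by simp

lemma defin_disj: "defin E D W k P \<Longrightarrow> defin E D W k Q \<Longrightarrow> defin E D W k (\<lambda>w s. P w s \<or> Q w s)"
  using defin_imp[OF defin_not, of E D W k P Q] by (rule defin_cong) auto

lemma defin_conj: "defin E D W k P \<Longrightarrow> defin E D W k Q \<Longrightarrow> defin E D W k (\<lambda>w s. P w s \<and> Q w s)"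
  using defin_not[OF defin_imp[OF _ defin_not], of E D W k P Q] by simp

lemma defin_iff: "defin E D W k P \<Longrightarrow> defin E D W k Q \<Longrightarrow> defin E D W k (\<lambda>w s. P w s = Q w s)"
  using defin_conj[OF defin_imp defin_imp, of E D W k P Q Q P] by (rule defin_cong) auto

lemma defin_ex:
  assumes "defin E D W (Suc k) (\<lambda>w s. Q w (s 0) (\<lambda>i. s (Suc i)))"
  shows "defin E D W k (\<lambda>w s. \<exists>x\<in>D w. Q w x s)"
  using defin_not[OF defin_all[where Q = "\<lambda>w x s. \<not> Q w x s", OF defin_not[OF assms]]] by simp

lemma defin_const: "defin E D W k (\<lambda>w s. c)"
  using defin_False[of E D W k] defin_not[OF defin_False, of E D W k] by (cases c) simp_all

text \<open>The bound is an external number, so this is a finite disjunction and no quantifier of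
  the formula.\<close>

lemma defin_ex_le:
  "(\<And>i. i \<le> (n::nat) \<Longrightarrow> defin E D W k (P i)) \<Longrightarrow> defin E D W k (\<lambda>w s. \<exists>i\<le>n. P i w s)"
proof (induction n)
  case (Suc n)
  then have "defin E D W k (\<lambda>w s. (\<exists>i\<le>n. P i w s) \<or> P (Suc n) w s)"
    by (intro defin_disj) auto
  then show ?case by (rule defin_cong) (auto simp: le_Suc_eq)
qed simp

lemma defin_all_less:
  "(\<And>i. i < (n::nat) \<Longrightarrow> defin E D W k (P i)) \<Longrightarrow> defin E D W k (\<lambda>w s. \<forall>i<n. P i w s)"
proof (induction n)
  case 0
  then show ?case by (simp add: defin_const)
next
  case (Suc n)
  then have "defin E D W k (\<lambda>w s. (\<forall>i<n. P i w s) \<and> P n w s)"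
    by (intro defin_conj) auto
  then show ?case by (rule defin_cong) (auto simp: less_Suc_eq)
qed

section \<open>Definability over the whole universe\<close>

context ZFC
begin

text \<open>A single world whose domain is everything turns the closure rules above into first-order
  definability, as the axiom schemes ask for.\<close>

definition df :: "nat \<Rightarrow> ((nat \<Rightarrow> 'a) \<Rightarrow> bool) \<Rightarrow> bool" where
  "df k P \<longleftrightarrow> defin E (\<lambda>_::unit. UNIV) UNIV k (\<lambda>_. P)"

lemma df_intros:
  "i < k \<Longrightarrow> j < k \<Longrightarrow> df k (\<lambda>s. E (s i) (s j))"
  "i < k \<Longrightarrow> j < k \<Longrightarrow> df k (\<lambda>s. s i = s j)"
  "df k P \<Longrightarrow> df k (\<lambda>s. \<not> P s)"
  "df k P \<Longrightarrow> df k Q \<Longrightarrow> df k (\<lambda>s. P s \<longrightarrow> Q s)"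
  "df k P \<Longrightarrow> df k Q \<Longrightarrow> df k (\<lambda>s. P s \<and> Q s)"
  "df k P \<Longrightarrow> df k Q \<Longrightarrow> df k (\<lambda>s. P s \<or> Q s)"
  "df k P \<Longrightarrow> df k Q \<Longrightarrow> df k (\<lambda>s. P s = Q s)"
  "df (Suc k) (\<lambda>s. T (s 0) (\<lambda>i. s (Suc i))) \<Longrightarrow> df k (\<lambda>s. \<forall>x. T x s)"
  "df (Suc k) (\<lambda>s. T (s 0) (\<lambda>i. s (Suc i))) \<Longrightarrow> df k (\<lambda>s. \<exists>x. T x s)"
  unfolding df_def
  using defin_all[of E "\<lambda>_::unit. UNIV" UNIV k "\<lambda>_. T"]
    defin_ex[of E "\<lambda>_::unit. UNIV" UNIV k "\<lambda>_. T"]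
  by (simp_all add: defin_Mem defin_Eql defin_not defin_imp defin_conj defin_disj defin_iff)

lemma df_is_trans: "i < k \<Longrightarrow> df k (\<lambda>s. is_trans E (s i))"
  unfolding is_trans_def by (intro df_intros; simp)

lemma df_is_Ord: "i < k \<Longrightarrow> df k (\<lambda>s. is_Ord E (s i))"
  unfolding is_Ord_def by (intro df_intros df_is_trans; simp)

lemma df_is_upair: "i < k \<Longrightarrow> j < k \<Longrightarrow> l < k \<Longrightarrow> df k (\<lambda>s. is_upair E (s i) (s j) (s l))"
  unfolding is_upair_def by (intro df_intros; simp)

lemma df_is_opair: "i < k \<Longrightarrow> j < k \<Longrightarrow> l < k \<Longrightarrow> df k (\<lambda>s. is_opair E (s i) (s j) (s l))"
  unfolding is_opair_def by (intro df_intros df_is_upair; simp)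

lemma df_maps_to: "i < k \<Longrightarrow> j < k \<Longrightarrow> l < k \<Longrightarrow> df k (\<lambda>s. maps_to E (s i) (s j) (s l))"
  unfolding maps_to_def by (intro df_intros df_is_opair; simp)

lemmas df_rules = df_intros df_is_trans df_is_Ord df_is_upair df_is_opair df_maps_to

lemma df_fo_sat:
  assumes "df k P"
  shows "\<exists>\<phi>. nonmodal \<phi> \<and> params \<phi> = {} \<and> (\<forall>s. fo_sat E s \<phi> = P s)"
  using assms unfolding df_def defin_def fo_sat_def by auto

lemma sep:
  assumes "df 4 (\<lambda>s. P (s 0) (s 1) (s 2) (s 3))"
  shows "\<exists>b. \<forall>x. E x b \<longleftrightarrow> E x a \<and> P x p q r"
proof -
  obtain \<phi> where \<phi>: "nonmodal \<phi>" "params \<phi> = {}"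
      "\<And>s. fo_sat E s \<phi> = P (s 0) (s 1) (s 2) (s 3)"
    using df_fo_sat[OF assms] by auto
  show ?thesis
    using separation[OF \<phi>(1,2), of a "(\<lambda>_. p)(2 := q, 3 := r)"] by (simp add: \<phi>(3))
qed

lemma repl:
  assumes "df 4 (\<lambda>s. P (s 0) (s 1) (s 2) (s 3))" "\<And>x. E x a \<Longrightarrow> \<exists>!y. P x y c d"
  shows "\<exists>b. \<forall>y. E y b \<longleftrightarrow> (\<exists>x. E x a \<and> P x y c d)"
proof -
  obtain \<phi> where \<phi>: "nonmodal \<phi>" "params \<phi> = {}"
      "\<And>s. fo_sat E s \<phi> = P (s 0) (s 1) (s 2) (s 3)"
    using df_fo_sat[OF assms(1)] by auto
  show ?thesis
    using replacement[OF \<phi>(1,2), of a "(\<lambda>_. c)(3 := d)"] assms(2) by (simp add: \<phi>(3))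
qed

section \<open>Ordinals and recursion in the model\<close>

lemma E_THE:
  assumes "\<exists>b. \<forall>x. E x b \<longleftrightarrow> P x"
  shows "E x (THE b. \<forall>x. E x b \<longleftrightarrow> P x) \<longleftrightarrow> P x"
proof -
  obtain b where b: "\<forall>x. E x b \<longleftrightarrow> P x" using assms by blast
  have "\<forall>x. E x (THE b. \<forall>x. E x b \<longleftrightarrow> P x) \<longleftrightarrow> P x"
  proof (rule theI, rule b)
    fix c assume "\<forall>x. E x c \<longleftrightarrow> P x"
    then show "c = b" by (intro extensionality) (simp add: b)
  qed
  then show ?thesis by blast
qed

definition up :: "'a \<Rightarrow> 'a \<Rightarrow> 'a" where "up a b = (THE c. \<forall>x. E x c \<longleftrightarrow> x = a \<or> x = b)"

lemma E_up: "E x (up a b) \<longleftrightarrow> x = a \<or> x = b"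
  unfolding up_def by (rule E_THE[OF pairing])

lemma up_eq: "up a b = up c d \<longleftrightarrow> (a = c \<and> b = d) \<or> (a = d \<and> b = c)"
proof
  assume "up a b = up c d"
  then have "\<And>x. (x = a \<or> x = b) = (x = c \<or> x = d)" using E_up by metis
  then show "(a = c \<and> b = d) \<or> (a = d \<and> b = c)" by metis
next
  assume "(a = c \<and> b = d) \<or> (a = d \<and> b = c)"
  then show "up a b = up c d" by (intro extensionality) (auto simp: E_up)
qed

definition opr :: "'a \<Rightarrow> 'a \<Rightarrow> 'a" where "opr a b = up (up a a) (up a b)"

lemma opr_eq: "opr a b = opr c d \<longleftrightarrow> a = c \<and> b = d"
  unfolding opr_def up_eq by auto

lemma is_upair_iff: "is_upair E a b c \<longleftrightarrow> c = up a b"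
  unfolding is_upair_def using extensionality[of c "up a b"] by (auto simp: E_up)

lemma is_opair_iff: "is_opair E a b c \<longleftrightarrow> c = opr a b"
  unfolding is_opair_def is_upair_iff opr_def by simp

lemma maps_to_iff: "maps_to E f x y \<longleftrightarrow> E (opr x y) f"
  unfolding maps_to_def is_opair_iff by simp

definition un :: "'a \<Rightarrow> 'a" where "un a = (THE b. \<forall>x. E x b \<longleftrightarrow> (\<exists>y. E x y \<and> E y a))"

lemma E_un: "E x (un a) \<longleftrightarrow> (\<exists>y. E x y \<and> E y a)"
  unfolding un_def by (rule E_THE[OF union])

definition ins :: "'a \<Rightarrow> 'a \<Rightarrow> 'a" where "ins x a = un (up a (up x x))"

lemma E_ins: "E z (ins x a) \<longleftrightarrow> z = x \<or> E z a"
  unfolding ins_def E_un E_up by (metis E_up)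

abbreviation "sc x \<equiv> ins x x"

lemma E_irrefl: "\<not> E x x"
  using foundation[of x "up x x"] by (auto simp: E_up)

lemma E_asym: "E x y \<Longrightarrow> \<not> E y x"
  using foundation[of x "up x y"] by (auto simp: E_up)

abbreviation "Ord \<equiv> is_Ord E"

lemma Ord_in: "Ord a \<Longrightarrow> E x a \<Longrightarrow> Ord x"
  unfolding is_Ord_def is_trans_def by blast

lemma Ord_trans: "Ord c \<Longrightarrow> E b c \<Longrightarrow> E a b \<Longrightarrow> E a c"
  unfolding is_Ord_def is_trans_def by blast

lemma Ord_sc: "Ord a \<Longrightarrow> Ord (sc a)"
  unfolding is_Ord_def is_trans_def E_ins by blast

lemma Ord_un: "(\<And>x. E x a \<Longrightarrow> Ord x) \<Longrightarrow> Ord (un a)"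
  unfolding is_Ord_def is_trans_def E_un by blast

text \<open>Separation cuts the witnesses down to a set bounded by the successor of a, to which
  foundation applies; transitivity makes its minimal element least.\<close>

lemma Ord_least:
  assumes "df 4 (\<lambda>s. P (s 0) (s 1) (s 2) (s 3))" "Ord a" "P a p q r"
  shows "\<exists>m. Ord m \<and> P m p q r \<and> (\<forall>x. E x m \<longrightarrow> \<not> P x p q r)"
proof -
  obtain b where b: "\<And>x. E x b \<longleftrightarrow> E x (sc a) \<and> P x p q r"
    using sep[OF assms(1), of "sc a" p q r] by blast
  have "E a b" using assms(3) by (simp add: b E_ins)
  then obtain m where m: "E m b" "\<not> (\<exists>z. E z m \<and> E z b)" using foundation by blast
  have sa: "Ord (sc a)" using Ord_sc assms(2) by blast
  have "E m (sc a)" "P m p q r" using m(1) b by auto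
  moreover have "\<not> P x p q r" if "E x m" for x
    using m(2) that b Ord_trans[OF sa] \<open>E m (sc a)\<close> by blast
  ultimately show ?thesis using Ord_in[OF sa] by blast
qed

lemma Ord_induct:
  assumes "df 4 (\<lambda>s. P (s 0) (s 1) (s 2) (s 3))" "Ord a"
    and step: "\<And>a. Ord a \<Longrightarrow> (\<And>x. E x a \<Longrightarrow> P x p q r) \<Longrightarrow> P a p q r"
  shows "P a p q r"
proof (rule ccontr)
  assume n: "\<not> P a p q r"
  have "df 4 (\<lambda>s. \<not> P (s 0) (s 1) (s 2) (s 3))" by (rule df_intros assms(1))+
  from Ord_least[where P = "\<lambda>x p q r. \<not> P x p q r", OF this assms(2) n] show False
    using step by blast
qed

lemma Ord_linear:
  assumes "Ord a" "Ord b"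
  shows "E a b \<or> a = b \<or> E b a"
proof -
  let ?c = "\<lambda>a b. E a b \<or> a = b \<or> E b a"
  have "\<forall>b. Ord b \<longrightarrow> ?c a b"
  proof (rule Ord_induct[where P = "\<lambda>a _ _ _. \<forall>b. Ord b \<longrightarrow> ?c a b" and p = a])
    show "df 4 (\<lambda>s. \<forall>b. Ord b \<longrightarrow> ?c (s 0) b)" by (intro df_rules; simp)
  next
    fix a assume a: "Ord a" and IH: "\<And>x. E x a \<Longrightarrow> \<forall>b. Ord b \<longrightarrow> ?c x b"
    have "?c b a" if "Ord b" for b
    proof (rule Ord_induct[where P = "\<lambda>b a _ _. ?c b a" and p = a])
      show "df 4 (\<lambda>s. ?c (s 0) (s 1))" by (intro df_rules; simp)
    next
      fix b assume b: "Ord b" and IH': "\<And>x. E x b \<Longrightarrow> ?c x a"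
      show "?c b a"
      proof (rule ccontr)
        assume n: "\<not> ?c b a"
        \<comment> \<open>An element of a is comparable with b by the outer hypothesis; being b or
          lying above b would make b an element of a. The other direction uses the inner
          one.\<close>
        have "E x a = E x b" for x
          using IH[of x] IH'[of x] Ord_trans[OF a, of x b] Ord_trans[OF b, of x a] a b n
          by metis
        then show False using extensionality[of a b] n by blast
      qed
    qed (rule that)
    then show "\<forall>b. Ord b \<longrightarrow> ?c a b" by blast
  qed (rule assms(1))
  then show ?thesis using assms(2) by blast
qed

lemma Ord_subset:
  "Ord a \<Longrightarrow> Ord b \<Longrightarrow> (\<And>x. E x a \<Longrightarrow> E x b) \<Longrightarrow> E a b \<or> a = b"
  using Ord_linear E_irrefl by blast

text \<open>Abstracts \<open>rank_seq\<close> to an arbitrary clause \<Phi>, so that one recursion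
  theorem gives both the cumulative hierarchy and the enumeration of a class.\<close>

definition attempt :: "('a \<Rightarrow> 'a \<Rightarrow> 'a \<Rightarrow> 'a \<Rightarrow> bool) \<Rightarrow> 'a \<Rightarrow> 'a \<Rightarrow> 'a \<Rightarrow> bool" where
  "attempt \<Phi> p \<beta> f \<longleftrightarrow> (\<forall>\<alpha>. E \<alpha> \<beta> \<or> \<alpha> = \<beta> \<longrightarrow>
    (\<exists>!v. maps_to E f \<alpha> v) \<and> (\<forall>v. maps_to E f \<alpha> v \<longrightarrow> \<Phi> p f \<alpha> v))"

definition rec_clause :: "('a \<Rightarrow> 'a \<Rightarrow> 'a \<Rightarrow> 'a \<Rightarrow> bool) \<Rightarrow> bool" where
  "rec_clause \<Phi> \<longleftrightarrow>
    (\<forall>k i j l m. i < k \<and> j < k \<and> l < k \<and> m < k \<longrightarrow> df k (\<lambda>s. \<Phi> (s i) (s j) (s l) (s m))) \<and>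
    (\<forall>p f f' \<alpha> v. (\<forall>\<gamma> w. E \<gamma> \<alpha> \<longrightarrow> maps_to E f \<gamma> w = maps_to E f' \<gamma> w) \<longrightarrow> \<Phi> p f \<alpha> v \<longrightarrow> \<Phi> p f' \<alpha> v) \<and>
    (\<forall>p f \<alpha>. Ord p \<longrightarrow> Ord \<alpha> \<longrightarrow> (\<forall>\<gamma>. E \<gamma> \<alpha> \<longrightarrow> (\<exists>!w. maps_to E f \<gamma> w)) \<longrightarrow> (\<exists>!v. \<Phi> p f \<alpha> v))"

context
  fixes \<Phi> :: "'a \<Rightarrow> 'a \<Rightarrow> 'a \<Rightarrow> 'a \<Rightarrow> bool"
  assumes clause: "rec_clause \<Phi>"
begin

lemma df_clause:
  "i < k \<Longrightarrow> j < k \<Longrightarrow> l < k \<Longrightarrow> m < k \<Longrightarrow> df k (\<lambda>s. \<Phi> (s i) (s j) (s l) (s m))"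
  using clause unfolding rec_clause_def by blast

lemma clause_local:
  assumes "\<And>\<gamma> w. E \<gamma> \<alpha> \<Longrightarrow> maps_to E f \<gamma> w = maps_to E f' \<gamma> w" "\<Phi> p f \<alpha> v"
  shows "\<Phi> p f' \<alpha> v"
  using clause[unfolded rec_clause_def, THEN conjunct2, THEN conjunct1, rule_format, of \<alpha> f f'] assms
  by blast

lemma clause_total:
  assumes "Ord p" "Ord \<alpha>" "\<And>\<gamma>. E \<gamma> \<alpha> \<Longrightarrow> \<exists>!w. maps_to E f \<gamma> w"
  shows "\<exists>!v. \<Phi> p f \<alpha> v"
  using clause[unfolded rec_clause_def, THEN conjunct2, THEN conjunct2, rule_format, of p \<alpha> f] assms
  by blast

lemma df_attempt: "i < k \<Longrightarrow> j < k \<Longrightarrow> l < k \<Longrightarrow> df k (\<lambda>s. attempt \<Phi> (s i) (s j) (s l))"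
  unfolding attempt_def Ex1_def by (intro df_rules df_clause; simp)

lemma attempt_mono: "attempt \<Phi> p \<beta> f \<Longrightarrow> Ord \<beta> \<Longrightarrow> E \<alpha> \<beta> \<Longrightarrow> attempt \<Phi> p \<alpha> f"
  using Ord_trans[of \<beta> \<alpha>] unfolding attempt_def by (simp; metis)

lemma attempt_unique:
  assumes "Ord p" "Ord \<alpha>" "attempt \<Phi> p \<alpha> f" "attempt \<Phi> p \<alpha> f'"
  shows "maps_to E f \<alpha> v = maps_to E f' \<alpha> v"
proof -
  have "\<forall>f f'. attempt \<Phi> p \<alpha> f \<and> attempt \<Phi> p \<alpha> f' \<longrightarrow> (\<forall>v. maps_to E f \<alpha> v = maps_to E f' \<alpha> v)"
  proof (rule Ord_induct[where P = "\<lambda>\<alpha> p _ _. \<forall>f f'. attempt \<Phi> p \<alpha> f \<and> attempt \<Phi> p \<alpha> f' \<longrightarrow>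
        (\<forall>v. maps_to E f \<alpha> v = maps_to E f' \<alpha> v)" and p = p])
    show "df 4 (\<lambda>s. \<forall>f f'. attempt \<Phi> (s 1) (s 0) f \<and> attempt \<Phi> (s 1) (s 0) f' \<longrightarrow>
        (\<forall>v. maps_to E f (s 0) v = maps_to E f' (s 0) v))"
      by (intro df_rules df_attempt; simp)
  next
    fix a assume a: "Ord a" and IH: "\<And>x. E x a \<Longrightarrow> \<forall>f f'. attempt \<Phi> p x f \<and> attempt \<Phi> p x f' \<longrightarrow>
        (\<forall>v. maps_to E f x v = maps_to E f' x v)"
    have "maps_to E f a v = maps_to E f' a v" if f: "attempt \<Phi> p a f" "attempt \<Phi> p a f'" for f f' v
    proof -
      have agree: "maps_to E f \<gamma> w = maps_to E f' \<gamma> w" if "E \<gamma> a" for \<gamma> w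
        using IH[OF that] attempt_mono[OF f(1) a that] attempt_mono[OF f(2) a that] by blast
      have "\<exists>!w. maps_to E f \<gamma> w" if "E \<gamma> a" for \<gamma>
        using f(1) that unfolding attempt_def by blast
      then have "\<exists>!v. \<Phi> p f a v" using clause_total assms(1) a by blast
      moreover obtain v1 where v1: "\<And>v. maps_to E f a v \<longleftrightarrow> v = v1" "\<Phi> p f a v1"
        using f(1) unfolding attempt_def by metis
      moreover obtain v2 where v2: "\<And>v. maps_to E f' a v \<longleftrightarrow> v = v2" "\<Phi> p f' a v2"
        using f(2) unfolding attempt_def by metis
      moreover have "\<Phi> p f a v2" using clause_local[of a f' f, OF _ v2(2)] agree by blast
      ultimately have "v1 = v2" by blast
      then show ?thesis using v1(1) v2(1) by simp
    qed
    then show "\<forall>f f'. attempt \<Phi> p a f \<and> attempt \<Phi> p a f' \<longrightarrow>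
        (\<forall>v. maps_to E f a v = maps_to E f' a v)" by blast
  qed (rule assms(2))
  then show ?thesis using assms(3,4) by blast
qed

lemma attempt_exists:
  assumes p: "Ord p" and "Ord \<beta>"
  shows "\<exists>f. attempt \<Phi> p \<beta> f"
proof (rule Ord_induct[where P = "\<lambda>\<beta> p _ _. \<exists>f. attempt \<Phi> p \<beta> f" and p = p])
  show "df 4 (\<lambda>s. \<exists>f. attempt \<Phi> (s 1) (s 0) f)"
    by (intro df_rules df_attempt; simp)
next
  fix \<beta> assume \<beta>: "Ord \<beta>" and IH: "\<And>x. E x \<beta> \<Longrightarrow> \<exists>f. attempt \<Phi> p x f"
  \<comment> \<open>Pools the values of all attempts below \<beta>. By uniqueness it is functional,
    and quantifying over attempts keeps it definable, so replacement makes it a set.\<close>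
  define val where "val = (\<lambda>p \<gamma> v. \<exists>f. attempt \<Phi> p \<gamma> f \<and> maps_to E f \<gamma> v)"
  have val: "val p \<gamma> v \<longleftrightarrow> maps_to E f \<gamma> v" if "E \<gamma> \<beta>" "attempt \<Phi> p \<gamma> f" for \<gamma> v f
    using attempt_unique[OF p Ord_in[OF \<beta> that(1)]] that(2) unfolding val_def by blast
  have val1: "\<exists>!v. val p \<gamma> v" if \<gamma>: "E \<gamma> \<beta>" for \<gamma>
  proof -
    obtain f where f: "attempt \<Phi> p \<gamma> f" using IH \<gamma> by blast
    then have "\<exists>!v. maps_to E f \<gamma> v" unfolding attempt_def by blast
    then show ?thesis using val[OF \<gamma> f] by simp
  qed
  have d: "df 4 (\<lambda>s. \<exists>v. val (s 2) (s 0) v \<and> is_opair E (s 0) v (s 1))"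
    unfolding val_def by (intro df_rules df_attempt; simp)
  have "\<exists>!q. \<exists>v. val p \<gamma> v \<and> is_opair E \<gamma> v q" if "E \<gamma> \<beta>" for \<gamma>
    using val1[OF that] unfolding is_opair_iff by metis
  then obtain g where "\<And>q. E q g \<longleftrightarrow> (\<exists>\<gamma>. E \<gamma> \<beta> \<and> (\<exists>v. val p \<gamma> v \<and> is_opair E \<gamma> v q))"
    using repl[where P = "\<lambda>\<gamma> q p _. \<exists>v. val p \<gamma> v \<and> is_opair E \<gamma> v q", OF d, of \<beta> p] by blast
  then have g: "maps_to E g \<gamma> v \<longleftrightarrow> E \<gamma> \<beta> \<and> val p \<gamma> v" for \<gamma> v
    unfolding maps_to_iff is_opair_iff by (auto simp: opr_eq)
  have "\<exists>!v. \<Phi> p g \<beta> v" using val1 g by (intro clause_total p \<beta>) simp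
  then obtain v0 where v0: "\<Phi> p g \<beta> v0" by blast
  define h where "h = ins (opr \<beta> v0) g"
  have h: "maps_to E h \<gamma> v \<longleftrightarrow> (E \<gamma> \<beta> \<and> val p \<gamma> v) \<or> (\<gamma> = \<beta> \<and> v = v0)" for \<gamma> v
    using g[of \<gamma> v] unfolding maps_to_iff h_def E_ins opr_eq by blast
  have "attempt \<Phi> p \<beta> h"
    unfolding attempt_def
  proof (intro allI impI conjI)
    fix \<alpha> assume \<alpha>: "E \<alpha> \<beta> \<or> \<alpha> = \<beta>"
    show "\<exists>!v. maps_to E h \<alpha> v"
      using \<alpha> val1 E_irrefl unfolding h by metis
    fix v assume v: "maps_to E h \<alpha> v"
    show "\<Phi> p h \<alpha> v"
    proof (cases "\<alpha> = \<beta>")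
      case True
      then have "v = v0" using v h E_irrefl by blast
      moreover have "maps_to E g \<gamma> w = maps_to E h \<gamma> w" if "E \<gamma> \<beta>" for \<gamma> w
        unfolding g h using that E_irrefl by blast
      ultimately show ?thesis using clause_local[OF _ v0] True by blast
    next
      case False
      then have \<alpha>: "E \<alpha> \<beta>" "val p \<alpha> v" using \<alpha> v h by auto
      then obtain f where f: "attempt \<Phi> p \<alpha> f" "maps_to E f \<alpha> v" unfolding val_def by blast
      then have "\<Phi> p f \<alpha> v" unfolding attempt_def by blast
      moreover have "maps_to E f \<gamma> w = maps_to E h \<gamma> w" if "E \<gamma> \<alpha>" for \<gamma> w
      proof -
        have "E \<gamma> \<beta>" using Ord_trans[OF \<beta> \<alpha>(1) that] .
        then show ?thesis
          using val attempt_mono[OF f(1) Ord_in[OF \<beta> \<alpha>(1)] that] h E_irrefl by blast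
      qed
      ultimately show ?thesis using clause_local by blast
    qed
  qed
  then show "\<exists>f. attempt \<Phi> p \<beta> f" by blast
qed (rule assms(2))

end

section \<open>The cumulative hierarchy\<close>

definition rank_step :: "'a \<Rightarrow> 'a \<Rightarrow> 'a \<Rightarrow> 'a \<Rightarrow> bool" where
  "rank_step p f \<alpha> v \<longleftrightarrow>
    (\<forall>x. E x v \<longleftrightarrow> (\<exists>\<gamma> w. E \<gamma> \<alpha> \<and> maps_to E f \<gamma> w \<and> (\<forall>y. E y x \<longrightarrow> E y w)))"

lemma rank_seq_attempt: "rank_seq E \<beta> f = attempt rank_step p \<beta> f"
  unfolding rank_seq_def attempt_def rank_step_def ..

lemma df_rank_step:
  "i < k \<Longrightarrow> j < k \<Longrightarrow> l < k \<Longrightarrow> m < k \<Longrightarrow> df k (\<lambda>s. rank_step (s i) (s j) (s l) (s m))"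
  unfolding rank_step_def by (intro df_rules; simp)

lemma rank_step_local:
  assumes "\<And>\<gamma> w. E \<gamma> \<alpha> \<Longrightarrow> maps_to E f \<gamma> w = maps_to E f' \<gamma> w" "rank_step p f \<alpha> v"
  shows "rank_step p f' \<alpha> v"
  using assms(2) unfolding rank_step_def by (simp add: assms(1) cong: conj_cong)

lemma rank_step_total:
  assumes "\<And>\<gamma>. E \<gamma> \<alpha> \<Longrightarrow> \<exists>!w. maps_to E f \<gamma> w"
  shows "\<exists>!v. rank_step p f \<alpha> v"
proof -
  \<comment> \<open>The map from \<gamma> to the power set of its value; replacement collects the
    range, whose union is the new value.\<close>
  have d: "df 4 (\<lambda>s. \<exists>w. maps_to E (s 2) (s 0) w \<and> (\<forall>x. E x (s 1) \<longleftrightarrow> (\<forall>y. E y x \<longrightarrow> E y w)))"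
    by (intro df_rules; simp)
  have "\<exists>!q. \<exists>w. maps_to E f \<gamma> w \<and> (\<forall>x. E x q \<longleftrightarrow> (\<forall>y. E y x \<longrightarrow> E y w))" if \<gamma>: "E \<gamma> \<alpha>" for \<gamma>
  proof -
    obtain w where w: "\<And>v. maps_to E f \<gamma> v \<longleftrightarrow> v = w" using assms[OF \<gamma>] by metis
    obtain q where q: "\<And>x. E x q \<longleftrightarrow> (\<forall>y. E y x \<longrightarrow> E y w)" using powerset[of w] by blast
    show ?thesis
    proof (rule ex1I[of _ q])
      fix q' assume "\<exists>w. maps_to E f \<gamma> w \<and> (\<forall>x. E x q' \<longleftrightarrow> (\<forall>y. E y x \<longrightarrow> E y w))"
      then show "q' = q" by (intro extensionality) (auto simp: w q)
    qed (use w q in blast)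
  qed
  then obtain A where A: "\<And>q. E q A \<longleftrightarrow> (\<exists>\<gamma>. E \<gamma> \<alpha> \<and>
      (\<exists>w. maps_to E f \<gamma> w \<and> (\<forall>x. E x q \<longleftrightarrow> (\<forall>y. E y x \<longrightarrow> E y w))))"
    using repl[where P = "\<lambda>\<gamma> q f _. \<exists>w. maps_to E f \<gamma> w \<and>
      (\<forall>x. E x q \<longleftrightarrow> (\<forall>y. E y x \<longrightarrow> E y w))", OF d, of \<alpha> f] by blast
  have "E x (un A) \<longleftrightarrow> (\<exists>\<gamma> w. E \<gamma> \<alpha> \<and> maps_to E f \<gamma> w \<and> (\<forall>y. E y x \<longrightarrow> E y w))" for x
    unfolding E_un A using powerset by blast
  then have u: "rank_step p f \<alpha> (un A)" by (simp add: rank_step_def)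
  show ?thesis
  proof (rule ex1I, rule u)
    fix v assume "rank_step p f \<alpha> v"
    then show "v = un A" using u by (intro extensionality) (simp add: rank_step_def)
  qed
qed

lemma rec_clause_rank_step: "rec_clause rank_step"
  unfolding rec_clause_def
proof (intro conjI allI impI)
  fix p f f' \<alpha> v
  assume "\<forall>\<gamma> w. E \<gamma> \<alpha> \<longrightarrow> maps_to E f \<gamma> w = maps_to E f' \<gamma> w" "rank_step p f \<alpha> v"
  then show "rank_step p f' \<alpha> v" using rank_step_local by blast
next
  fix p f \<alpha>
  assume "\<forall>\<gamma>. E \<gamma> \<alpha> \<longrightarrow> (\<exists>!w. maps_to E f \<gamma> w)"
  then show "\<exists>!v. rank_step p f \<alpha> v" by (intro rank_step_total) simp
qed (simp add: df_rank_step)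

lemma rank_seq_exists: "Ord \<beta> \<Longrightarrow> \<exists>f. rank_seq E \<beta> f"
  using attempt_exists[OF rec_clause_rank_step, of \<beta> \<beta>]
  unfolding rank_seq_attempt[of _ _ \<beta>] by blast

lemma rank_seq_mono: "rank_seq E \<beta> f \<Longrightarrow> Ord \<beta> \<Longrightarrow> E \<alpha> \<beta> \<Longrightarrow> rank_seq E \<alpha> f"
  using attempt_mono[OF rec_clause_rank_step, of \<beta> \<beta> f \<alpha>]
  unfolding rank_seq_attempt[of _ _ \<beta>] by blast

lemma Vseg_value:
  assumes "Ord \<beta>" "rank_seq E \<beta> f" "maps_to E f \<beta> v"
  shows "x \<in> Vseg E \<beta> \<longleftrightarrow> E x v"
proof
  assume "x \<in> Vseg E \<beta>"
  then obtain g w where g: "rank_seq E \<beta> g" "maps_to E g \<beta> w" "E x w" by (auto simp: Vseg_def)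
  have "maps_to E f \<beta> w"
    using attempt_unique[OF rec_clause_rank_step, of \<beta> \<beta> f g w] g assms
    unfolding rank_seq_attempt[of _ _ \<beta>] by blast
  moreover have "\<exists>!v. maps_to E f \<beta> v" using assms(2) by (simp add: rank_seq_def)
  ultimately show "E x v" using assms(3) g(3) by blast
qed (use assms in \<open>auto simp: Vseg_def\<close>)

text \<open>The recursion equation with the witnessing sequences removed; apart from definability,
  all later facts about the worlds rest on it.\<close>

lemma Vseg_iff:
  assumes \<beta>: "Ord \<beta>"
  shows "x \<in> Vseg E \<beta> \<longleftrightarrow> (\<exists>\<gamma>. E \<gamma> \<beta> \<and> (\<forall>y. E y x \<longrightarrow> y \<in> Vseg E \<gamma>))"
proof -
  obtain f where f: "rank_seq E \<beta> f" using rank_seq_exists \<beta> by blast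
  then obtain v where v: "maps_to E f \<beta> v" by (auto simp: rank_seq_def)
  then have "x \<in> Vseg E \<beta> \<longleftrightarrow> E x v" using Vseg_value \<beta> f by blast
  also have "\<dots> \<longleftrightarrow> (\<exists>\<gamma> w. E \<gamma> \<beta> \<and> maps_to E f \<gamma> w \<and> (\<forall>y. E y x \<longrightarrow> E y w))"
    using f v by (simp add: rank_seq_def)
  also have "\<dots> \<longleftrightarrow> (\<exists>\<gamma>. E \<gamma> \<beta> \<and> (\<forall>y. E y x \<longrightarrow> y \<in> Vseg E \<gamma>))"
  proof (intro ex_cong1 iffI)
    fix \<gamma> assume "\<exists>w. E \<gamma> \<beta> \<and> maps_to E f \<gamma> w \<and> (\<forall>y. E y x \<longrightarrow> E y w)"
    then show "E \<gamma> \<beta> \<and> (\<forall>y. E y x \<longrightarrow> y \<in> Vseg E \<gamma>)"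
      using Vseg_value[OF Ord_in[OF \<beta>] rank_seq_mono[OF f \<beta>]] by blast
  next
    fix \<gamma> assume g: "E \<gamma> \<beta> \<and> (\<forall>y. E y x \<longrightarrow> y \<in> Vseg E \<gamma>)"
    then obtain w where w: "maps_to E f \<gamma> w" using f by (auto simp: rank_seq_def)
    then show "\<exists>w. E \<gamma> \<beta> \<and> maps_to E f \<gamma> w \<and> (\<forall>y. E y x \<longrightarrow> E y w)"
      using g Vseg_value[OF Ord_in[OF \<beta>] rank_seq_mono[OF f \<beta>] w] by blast
  qed
  finally show ?thesis .
qed

lemma Vseg_mono: "Ord \<beta> \<Longrightarrow> E \<gamma> \<beta> \<Longrightarrow> x \<in> Vseg E \<gamma> \<Longrightarrow> x \<in> Vseg E \<beta>"
  using Vseg_iff[of \<beta> x] Vseg_iff[of \<gamma> x] Ord_in[of \<beta> \<gamma>] Ord_trans[of \<beta> \<gamma>] by blast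

lemma Vseg_transitive: "Ord \<beta> \<Longrightarrow> x \<in> Vseg E \<beta> \<Longrightarrow> E y x \<Longrightarrow> y \<in> Vseg E \<beta>"
  using Vseg_iff[of \<beta> x] Vseg_mono[of \<beta> _ y] by blast

lemma df_Vseg: "i < k \<Longrightarrow> j < k \<Longrightarrow> df k (\<lambda>s. s i \<in> Vseg E (s j))"
  unfolding Vseg_def mem_Collect_eq rank_seq_def Ex1_def by (intro df_rules; simp)

lemma Ord_subset_Vseg:
  assumes "Ord \<alpha>"
  shows "\<forall>y. E y \<alpha> \<longrightarrow> y \<in> Vseg E \<alpha>"
proof (rule Ord_induct[where P = "\<lambda>\<alpha> _ _ _. \<forall>y. E y \<alpha> \<longrightarrow> y \<in> Vseg E \<alpha>" and p = \<alpha>])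
  show "df 4 (\<lambda>s. \<forall>y. E y (s 0) \<longrightarrow> y \<in> Vseg E (s 0))" by (intro df_rules df_Vseg; simp)
next
  fix a assume a: "Ord a" and "\<And>x. E x a \<Longrightarrow> \<forall>y. E y x \<longrightarrow> y \<in> Vseg E x"
  then show "\<forall>y. E y a \<longrightarrow> y \<in> Vseg E a" unfolding Vseg_iff[OF a] by blast
qed (rule assms)

text \<open>An ordinal of V_\<beta> is a subset of some V_\<gamma> with \<gamma> < \<beta>, hence by
  induction a subset of \<gamma>, hence at most \<gamma>.\<close>

lemma Ord_in_Vseg:
  assumes "Ord \<beta>"
  shows "\<alpha> \<in> Vseg E \<beta> \<and> Ord \<alpha> \<longleftrightarrow> E \<alpha> \<beta>"
proof -
  have "\<forall>\<alpha>. Ord \<alpha> \<and> \<alpha> \<in> Vseg E \<beta> \<longrightarrow> E \<alpha> \<beta>"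
  proof (rule Ord_induct[where P = "\<lambda>\<beta> _ _ _. \<forall>\<alpha>. Ord \<alpha> \<and> \<alpha> \<in> Vseg E \<beta> \<longrightarrow> E \<alpha> \<beta>" and p = \<beta>])
    show "df 4 (\<lambda>s. \<forall>\<alpha>. Ord \<alpha> \<and> \<alpha> \<in> Vseg E (s 0) \<longrightarrow> E \<alpha> (s 0))"
      by (intro df_rules df_Vseg; simp)
  next
    fix b assume b: "Ord b" and IH: "\<And>x. E x b \<Longrightarrow> \<forall>\<alpha>. Ord \<alpha> \<and> \<alpha> \<in> Vseg E x \<longrightarrow> E \<alpha> x"
    have "E \<alpha> b" if \<alpha>: "Ord \<alpha>" "\<alpha> \<in> Vseg E b" for \<alpha>
    proof -
      obtain \<gamma> where \<gamma>: "E \<gamma> b" "\<forall>y. E y \<alpha> \<longrightarrow> y \<in> Vseg E \<gamma>" using \<alpha>(2) Vseg_iff[OF b] by blast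
      then have "E y \<gamma>" if "E y \<alpha>" for y using IH that Ord_in[OF \<alpha>(1)] by blast
      then show ?thesis using Ord_subset[OF \<alpha>(1) Ord_in[OF b \<gamma>(1)]] Ord_trans[OF b \<gamma>(1)] \<gamma>(1)
        by blast
    qed
    then show "\<forall>\<alpha>. Ord \<alpha> \<and> \<alpha> \<in> Vseg E b \<longrightarrow> E \<alpha> b" by blast
  qed (rule assms)
  then show ?thesis using Ord_subset_Vseg[OF assms] Ord_in[OF assms] by blast
qed

section \<open>Limits of definable classes\<close>

text \<open>\<open>C\<close> is cofinal in a nonempty \<delta>. Only elements of \<delta> are
  quantified over, which makes the property expressible at V_\<delta>.\<close>

definition limit_of :: "('a \<Rightarrow> bool) \<Rightarrow> 'a \<Rightarrow> bool" where
  "limit_of C \<delta> \<longleftrightarrow> (\<exists>x. E x \<delta>) \<and> (\<forall>x. E x \<delta> \<longrightarrow> (\<exists>y. E y \<delta> \<and> E x y \<and> C y))"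

lemma infinite_ordinal: "\<exists>\<mu>. Ord \<mu> \<and> limit_of Ord \<mu>"
proof -
  obtain a e where a: "E e a" "\<And>x. \<not> E x e"
    "\<And>x. E x a \<Longrightarrow> \<exists>y. E y a \<and> (\<forall>z. E z y \<longleftrightarrow> E z x \<or> z = x)"
    using infinity by blast
  have d: "df 4 (\<lambda>s. Ord (s 0) \<and> (\<forall>y. E y (s 0) \<longrightarrow> E y (s 1)))"
    by (intro df_rules; simp)
  \<comment> \<open>Keeping only ordinals that are also subsets of a makes b transitive and
    preserves closure under successors.\<close>
  obtain b where b: "\<And>x. E x b \<longleftrightarrow> E x a \<and> Ord x \<and> (\<forall>y. E y x \<longrightarrow> E y a)"
    using sep[where P = "\<lambda>x a _ _. Ord x \<and> (\<forall>y. E y x \<longrightarrow> E y a)", OF d, of a a] by blast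
  have "E (sc x) a" if "E x a" for x
  proof -
    obtain y where y: "E y a" "\<forall>z. E z y \<longleftrightarrow> E z x \<or> z = x" using a(3)[OF \<open>E x a\<close>] by blast
    then have "y = sc x" by (intro extensionality) (auto simp: E_ins)
    then show ?thesis using y(1) by simp
  qed
  then have sc: "E (sc x) b" if "E x b" for x
    using that Ord_sc unfolding b E_ins by blast
  have "Ord e" using a(2) by (simp add: is_Ord_def is_trans_def)
  then have "E e b" using a unfolding b by blast
  moreover have "Ord b"
    unfolding is_Ord_def is_trans_def b using Ord_in Ord_trans by blast
  moreover have "limit_of Ord b"
    unfolding limit_of_def using \<open>E e b\<close> sc b E_ins by blast
  ultimately show ?thesis by blast
qed

text \<open>The closure points are suprema of sequences of length a limit ordinal that enumerate
  the class \<open>C\<close> beyond \<open>\<delta>\<close> in increasing order.\<close>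

lemma limit_of_unbounded:
  assumes df_C: "\<And>k i. i < k \<Longrightarrow> df k (\<lambda>s. C (s i))"
    and C_Ord: "\<And>x. C x \<Longrightarrow> Ord x"
    and unb: "\<And>\<delta>. Ord \<delta> \<Longrightarrow> \<exists>c. C c \<and> E \<delta> c"
    and \<delta>: "Ord \<delta>"
  shows "\<exists>l. Ord l \<and> limit_of C l \<and> E \<delta> l"
proof -
  \<comment> \<open>Taking the least such v makes the enumeration free of choice. The guard
    \<open>Ord w\<close> keeps the clause total when \<open>f\<close> has values that are no
    ordinals.\<close>
  define bd where "bd = (\<lambda>p f \<alpha> v. C v \<and> E p v \<and>
    (\<forall>\<gamma> w. E \<gamma> \<alpha> \<longrightarrow> maps_to E f \<gamma> w \<longrightarrow> Ord w \<longrightarrow> E w v))"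
  define \<Phi> where "\<Phi> = (\<lambda>p f \<alpha> v. bd p f \<alpha> v \<and> (\<forall>u. E u v \<longrightarrow> \<not> bd p f \<alpha> u))"
  have df_bd: "df k (\<lambda>s. bd (s i) (s j) (s l) (s m))" if "i < k" "j < k" "l < k" "m < k" for k i j l m
    unfolding bd_def using that by (intro df_rules df_C; simp)
  have df_\<Phi>: "df k (\<lambda>s. \<Phi> (s i) (s j) (s l) (s m))" if "i < k" "j < k" "l < k" "m < k" for k i j l m
    unfolding \<Phi>_def using that by (intro df_rules df_bd; simp)
  have bd_local: "bd p f \<alpha> v = bd p f' \<alpha> v"
    if "\<And>\<gamma> w. E \<gamma> \<alpha> \<Longrightarrow> maps_to E f \<gamma> w = maps_to E f' \<gamma> w" for p f f' \<alpha> v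
    unfolding bd_def using that by simp
  have local: "\<Phi> p f' \<alpha> v"
    if "\<And>\<gamma> w. E \<gamma> \<alpha> \<Longrightarrow> maps_to E f \<gamma> w = maps_to E f' \<gamma> w" "\<Phi> p f \<alpha> v" for p f f' \<alpha> v
    using that(2) bd_local[of \<alpha> f f', OF that(1)] by (simp add: \<Phi>_def)
  have total: "\<exists>!v. \<Phi> p f \<alpha> v"
    if p: "Ord p" and \<alpha>: "Ord \<alpha>" and f: "\<And>\<gamma>. E \<gamma> \<alpha> \<Longrightarrow> \<exists>!w. maps_to E f \<gamma> w" for p f \<alpha>
  proof -
    have d: "df 4 (\<lambda>s. maps_to E (s 2) (s 0) (s 1))" by (intro df_rules; simp)
    obtain A where A: "\<And>w. E w A \<longleftrightarrow> (\<exists>\<gamma>. E \<gamma> \<alpha> \<and> maps_to E f \<gamma> w)"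
      using repl[where P = "\<lambda>\<gamma> w f _. maps_to E f \<gamma> w", OF d f] by blast
    have d: "df 4 (\<lambda>s. Ord (s 0))" by (intro df_rules; simp)
    obtain B where B: "\<And>w. E w B \<longleftrightarrow> E w A \<and> Ord w"
      using sep[where P = "\<lambda>w _ _ _. Ord w", OF d, of A] by blast
    have U: "Ord (un B)" using B by (intro Ord_un) blast
    \<comment> \<open>The larger of p and the supremum of the earlier ordinal values; anything in
      \<open>C\<close> above it qualifies.\<close>
    obtain m where m: "Ord m" "E p m \<or> p = m" "E (un B) m \<or> un B = m"
      using Ord_linear[OF p U] p U by blast
    obtain c where c: "C c" "E m c" using unb[OF m(1)] by blast
    have Oc: "Ord c" using C_Ord c by blast
    have "E w c" if w: "E w B" for w
    proof -
      have "E w (un B) \<or> w = un B" using B w E_un by (intro Ord_subset[OF _ U]) blast+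
      then show ?thesis using m(3) c(2) Ord_trans[OF Oc] Ord_trans[OF m(1)] by metis
    qed
    then have "bd p f \<alpha> c" using c m(2) Ord_trans[OF Oc c(2)] A B unfolding bd_def by blast
    moreover have d: "df 4 (\<lambda>s. bd (s 1) (s 2) (s 3) (s 0))" by (intro df_bd; simp)
    ultimately obtain v where v: "Ord v" "bd p f \<alpha> v" "\<And>u. E u v \<Longrightarrow> \<not> bd p f \<alpha> u"
      using Ord_least[where P = "\<lambda>v p f \<alpha>. bd p f \<alpha> v", OF d Oc, of p f \<alpha>] by blast
    have uniq: "v' = v" if "\<Phi> p f \<alpha> v'" for v'
    proof -
      have "C v'" using that by (simp add: \<Phi>_def bd_def)
      then show ?thesis using that v Ord_linear[OF v(1), of v'] C_Ord unfolding \<Phi>_def by blast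
    qed
    have "\<Phi> p f \<alpha> v" using v by (simp add: \<Phi>_def)
    then show ?thesis using uniq by (rule ex1I)
  qed
  have clause: "rec_clause \<Phi>"
    unfolding rec_clause_def
  proof (intro conjI allI impI)
    fix p f f' \<alpha> v
    assume "\<forall>\<gamma> w. E \<gamma> \<alpha> \<longrightarrow> maps_to E f \<gamma> w = maps_to E f' \<gamma> w" "\<Phi> p f \<alpha> v"
    then show "\<Phi> p f' \<alpha> v" using local by blast
  next
    fix p f \<alpha>
    assume "Ord p" "Ord \<alpha>" "\<forall>\<gamma>. E \<gamma> \<alpha> \<longrightarrow> (\<exists>!w. maps_to E f \<gamma> w)"
    then show "\<exists>!v. \<Phi> p f \<alpha> v" using total by blast
  qed (simp add: df_\<Phi>)
  obtain \<mu> where \<mu>: "Ord \<mu>" "limit_of Ord \<mu>" using infinite_ordinal by blast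
  obtain f where f: "attempt \<Phi> \<delta> \<mu> f"
    using attempt_exists[OF clause \<delta> \<mu>(1)] by blast
  have d: "df 4 (\<lambda>s. maps_to E (s 2) (s 0) (s 1))" by (intro df_rules; simp)
  have f1: "\<exists>!v. maps_to E f \<gamma> v" if "E \<gamma> \<mu>" for \<gamma> using f that unfolding attempt_def by blast
  obtain A where A: "\<And>w. E w A \<longleftrightarrow> (\<exists>\<gamma>. E \<gamma> \<mu> \<and> maps_to E f \<gamma> w)"
    using repl[where P = "\<lambda>\<gamma> w f _. maps_to E f \<gamma> w", OF d f1] by blast
  have bdA: "bd \<delta> f \<gamma> w" if "E \<gamma> \<mu>" "maps_to E f \<gamma> w" for \<gamma> w
    using f that unfolding attempt_def \<Phi>_def by blast
  then have CA: "C w" "Ord w" "E \<delta> w" if "E w A" for w using A that C_Ord unfolding bd_def by blast+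
  \<comment> \<open>As \<mu> has no last element, neither has the set of values, so its supremum is
    a limit of \<open>C\<close>.\<close>
  have up: "\<exists>w'. E w' A \<and> E w w'" if w: "E w A" for w
  proof -
    obtain \<gamma> where \<gamma>: "E \<gamma> \<mu>" "maps_to E f \<gamma> w" using A w by blast
    obtain \<gamma>' where \<gamma>': "E \<gamma>' \<mu>" "E \<gamma> \<gamma>'" using \<mu>(2) \<gamma>(1) unfolding limit_of_def by blast
    obtain w' where w': "maps_to E f \<gamma>' w'" using f1[OF \<gamma>'(1)] by blast
    have "E w w'" using bdA[OF \<gamma>'(1) w'] \<gamma>'(2) \<gamma>(2) CA(2)[OF w] unfolding bd_def by blast
    then show ?thesis using A \<gamma>'(1) w' by blast
  qed
  obtain w0 where w0: "E w0 A" using \<mu>(2) f1 A unfolding limit_of_def by metis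
  have "Ord (un A)" using CA by (intro Ord_un) blast
  moreover have "E \<delta> (un A)" using w0 CA(3) E_un by blast
  moreover have "limit_of C (un A)"
    unfolding limit_of_def
  proof (intro conjI allI impI)
    show "\<exists>x. E x (un A)" using \<open>E \<delta> (un A)\<close> by blast
  next
    fix x assume "E x (un A)"
    then obtain w where w: "E x w" "E w A" using E_un by blast
    then have "E w (un A)" using up E_un by blast
    then show "\<exists>y. E y (un A) \<and> E x y \<and> C y" using w CA(1) by blast
  qed
  ultimately show ?thesis by blast
qed

section \<open>The labelling of the worlds\<close>

text \<open>One formula must work at all worlds V_w at once, and \<open>P\<close> may depend on the
  index w itself.\<close>

definition wd :: "nat \<Rightarrow> ('a \<Rightarrow> (nat \<Rightarrow> 'a) \<Rightarrow> bool) \<Rightarrow> bool" where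
  "wd = defin E (Vseg E) {\<beta>. Ord \<beta>}"

lemma wd_cong:
  "wd k P \<Longrightarrow> (\<And>w s. Ord w \<Longrightarrow> (\<And>i. i < k \<Longrightarrow> s i \<in> Vseg E w) \<Longrightarrow> P w s = Q w s) \<Longrightarrow> wd k Q"
  unfolding wd_def by (erule defin_cong) auto

lemma wd_basic:
  "i < k \<Longrightarrow> j < k \<Longrightarrow> wd k (\<lambda>w s. E (s i) (s j))"
  "i < k \<Longrightarrow> j < k \<Longrightarrow> wd k (\<lambda>w s. s i = s j)"
  "wd k (\<lambda>w s. c)"
  "wd k P \<Longrightarrow> wd k (\<lambda>w s. \<not> P w s)"
  "wd k P \<Longrightarrow> wd k Q \<Longrightarrow> wd k (\<lambda>w s. P w s \<longrightarrow> Q w s)"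
  "wd k P \<Longrightarrow> wd k Q \<Longrightarrow> wd k (\<lambda>w s. P w s \<and> Q w s)"
  "wd k P \<Longrightarrow> wd k Q \<Longrightarrow> wd k (\<lambda>w s. P w s \<or> Q w s)"
  unfolding wd_def
  by (simp_all add: defin_Mem defin_Eql defin_const defin_not defin_imp defin_conj defin_disj)

lemma wd_bex:
  assumes "i < k" "wd (Suc k) (\<lambda>w s. Q w (s 0) (\<lambda>i. s (Suc i)))"
  shows "wd k (\<lambda>w s. \<exists>x. E x (s i) \<and> Q w x s)"
proof (rule wd_cong)
  show "wd k (\<lambda>w s. \<exists>x\<in>Vseg E w. E x (s i) \<and> Q w x s)"
    using assms unfolding wd_def by (intro defin_ex defin_conj defin_Mem) auto
qed (use Vseg_transitive assms(1) in blast)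

lemma wd_ball:
  assumes "i < k" "wd (Suc k) (\<lambda>w s. Q w (s 0) (\<lambda>i. s (Suc i)))"
  shows "wd k (\<lambda>w s. \<forall>x. E x (s i) \<longrightarrow> Q w x s)"
  using wd_basic(4)[OF wd_bex[where Q = "\<lambda>w x s. \<not> Q w x s", OF assms(1) wd_basic(4)[OF assms(2)]]]
  by simp

lemma wd_Ord:
  assumes "i < k"
  shows "wd k (\<lambda>w s. Ord (s i))"
proof -
  \<comment> \<open>\<open>is_trans\<close> quantifies over the universe; this form has only bounded
    quantifiers.\<close>
  have "Ord a \<longleftrightarrow> (\<forall>y. E y a \<longrightarrow> (\<forall>x. E x y \<longrightarrow> E x a)) \<and>
      (\<forall>z. E z a \<longrightarrow> (\<forall>y. E y z \<longrightarrow> (\<forall>x. E x y \<longrightarrow> E x z)))" for a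
    unfolding is_Ord_def is_trans_def by blast
  then show ?thesis using assms by (simp only:) (intro wd_ball wd_basic; simp)
qed

text \<open>The ordinals of the world \<open>V\<^sub>w\<close> are the elements of \<open>w\<close>. Hence a property of \<open>w\<close> that
  quantifies over elements of \<open>w\<close> is expressible by a sentence at \<open>V\<^sub>w\<close>, although \<open>w\<close> is not
  in \<open>V\<^sub>w\<close>.\<close>

lemma wd_bex_world:
  assumes "wd (Suc k) (\<lambda>w s. Q w (s 0) (\<lambda>i. s (Suc i)))"
  shows "wd k (\<lambda>w s. \<exists>x. E x w \<and> Q w x s)"
proof (rule wd_cong)
  show "wd k (\<lambda>w s. \<exists>x\<in>Vseg E w. Ord x \<and> Q w x s)"
    using assms wd_Ord[of 0 "Suc k"] unfolding wd_def by (intro defin_ex defin_conj) auto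
qed (use Ord_in_Vseg in blast)

lemma wd_ball_world:
  assumes "wd (Suc k) (\<lambda>w s. Q w (s 0) (\<lambda>i. s (Suc i)))"
  shows "wd k (\<lambda>w s. \<forall>x. E x w \<longrightarrow> Q w x s)"
  using wd_basic(4)[OF wd_bex_world[where Q = "\<lambda>w x s. \<not> Q w x s", OF wd_basic(4)[OF assms]]]
  by simp

lemma wd_nonempty: "i < k \<Longrightarrow> wd k (\<lambda>w s. \<exists>x. E x (s i))"
  using wd_bex[where Q = "\<lambda>w x s. True", OF _ wd_basic(3)] by simp

lemma wd_nonempty_world: "wd k (\<lambda>w s. \<exists>x. E x w)"
  using wd_bex_world[where Q = "\<lambda>w x s. True", OF wd_basic(3)] by simp

lemmas wd_rules = wd_ball wd_bex wd_ball_world wd_bex_world wd_nonempty wd_nonempty_world wd_Ord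
  wd_basic(1,2,4-)

definition limit :: "'a \<Rightarrow> bool" where "limit x \<longleftrightarrow> Ord x \<and> limit_of Ord x"

definition limit2 :: "'a \<Rightarrow> bool" where "limit2 x \<longleftrightarrow> limit_of limit x"

lemma df_limit_of:
  assumes "\<And>k i. i < k \<Longrightarrow> df k (\<lambda>s. C (s i))" "i < k"
  shows "df k (\<lambda>s. limit_of C (s i))"
  unfolding limit_of_def using assms(2) by (intro df_rules assms(1); simp)

lemma df_limit: "i < k \<Longrightarrow> df k (\<lambda>s. limit (s i))"
  unfolding limit_def by (intro df_rules df_limit_of)

lemma df_limit2: "i < k \<Longrightarrow> df k (\<lambda>s. limit2 (s i))"
  unfolding limit2_def by (intro df_limit_of df_limit)

lemma wd_limit: "i < k \<Longrightarrow> wd k (\<lambda>w s. limit (s i))"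
  unfolding limit_def limit_of_def by (intro wd_rules; simp)

lemma wd_limit2: "i < k \<Longrightarrow> wd k (\<lambda>w s. limit2 (s i))"
  unfolding limit2_def limit_of_def by (intro wd_rules wd_limit; simp)

lemma wd_limit2_world: "wd k (\<lambda>w s. limit2 w)"
  unfolding limit2_def limit_of_def by (intro wd_rules wd_limit; simp)

lemma limit_unbounded: "Ord \<delta> \<Longrightarrow> \<exists>l. limit l \<and> E \<delta> l"
  using limit_of_unbounded[of Ord \<delta>, OF df_is_Ord] Ord_sc E_ins unfolding limit_def by blast

lemma limit2_unbounded: "Ord \<delta> \<Longrightarrow> \<exists>l. Ord l \<and> limit2 l \<and> E \<delta> l"
  using limit_of_unbounded[of limit \<delta>, OF df_limit] limit_unbounded
  unfolding limit_def limit2_def by blast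

text \<open>Provides the interval above \<delta> in which the second coordinate can move while the
  stage stays fixed.\<close>

lemma next_limit2:
  assumes \<delta>: "Ord \<delta>"
  shows "\<exists>\<mu>. Ord \<mu> \<and> limit2 \<mu> \<and> E \<delta> \<mu> \<and> (\<forall>x. E x \<mu> \<and> limit2 x \<longrightarrow> E x \<delta> \<or> x = \<delta>)"
proof -
  obtain l where l: "Ord l" "limit2 l \<and> E \<delta> l" using limit2_unbounded[OF \<delta>] by blast
  have d: "df 4 (\<lambda>s. limit2 (s 0) \<and> E (s 1) (s 0))" by (intro df_rules df_limit2; simp)
  obtain \<mu> where \<mu>: "Ord \<mu>" "limit2 \<mu> \<and> E \<delta> \<mu>" "\<forall>x. E x \<mu> \<longrightarrow> \<not> (limit2 x \<and> E \<delta> x)"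
    using Ord_least[where P = "\<lambda>x \<delta> _ _. limit2 x \<and> E \<delta> x", OF d l] by blast
  have "E x \<delta> \<or> x = \<delta>" if "E x \<mu>" "limit2 x" for x
    using \<mu>(3) that Ord_linear[OF \<delta> Ord_in[OF \<mu>(1) that(1)]] by blast
  then show ?thesis using \<mu> by blast
qed

text \<open>\<open>offset j \<delta>\<close> says that \<open>\<delta> = \<lambda> + j\<close> with \<open>\<lambda>\<close> zero or a limit.\<close>

primrec offset :: "nat \<Rightarrow> 'a \<Rightarrow> bool" where
  "offset 0 \<delta> = (\<forall>x. E x \<delta> \<longrightarrow> (\<exists>y. E y \<delta> \<and> E x y))"
| "offset (Suc j) \<delta> = (\<exists>\<gamma>. E \<gamma> \<delta> \<and> (\<forall>x. E x \<delta> \<longrightarrow> E x \<gamma> \<or> x = \<gamma>) \<and> offset j \<gamma>)"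

lemma wd_offset: "i < k \<Longrightarrow> wd k (\<lambda>w s. offset j (s i))"
proof (induction j arbitrary: i k)
  case 0
  then show ?case unfolding offset.simps by (intro wd_rules; simp)
next
  case (Suc j)
  then show ?case unfolding offset.simps by (intro wd_rules Suc.IH; simp)
qed

lemma wd_offset_world: "wd k (\<lambda>w s. offset j w)"
  by (cases j; simp only: offset.simps; intro wd_rules wd_offset; simp)

text \<open>A largest element is unique and rules out offset 0, so predecessors can be peeled off in
  parallel.\<close>

lemma offset_unique: "offset i \<delta> \<Longrightarrow> offset j \<delta> \<Longrightarrow> i = j"
proof (induction i arbitrary: j \<delta>)
  case 0
  then show ?case using E_asym E_irrefl by (cases j; simp) metis
next
  case (Suc i)
  then show ?case
  proof (cases j)
    case 0
    then show ?thesis using Suc.prems E_asym E_irrefl by simp metis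
  next
    case (Suc j')
    obtain \<gamma> where \<gamma>: "E \<gamma> \<delta>" "\<forall>x. E x \<delta> \<longrightarrow> E x \<gamma> \<or> x = \<gamma>" "offset i \<gamma>"
      using Suc.prems(1) by auto
    obtain \<gamma>' where \<gamma>': "E \<gamma>' \<delta>" "\<forall>x. E x \<delta> \<longrightarrow> E x \<gamma>' \<or> x = \<gamma>'" "offset j' \<gamma>'"
      using Suc.prems(2) Suc by auto
    have "\<gamma> = \<gamma>'" using \<gamma> \<gamma>' E_asym by blast
    then show ?thesis using Suc.IH[OF \<gamma>(3)] \<gamma>'(3) Suc by blast
  qed
qed

text \<open>At least \<open>k\<close> limits of limits lie strictly below the ordinal \<delta>; the
  descending chain keeps all quantifiers bounded.\<close>

primrec limit2_chain :: "nat \<Rightarrow> 'a \<Rightarrow> bool" where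
  "limit2_chain 0 \<delta> = True"
| "limit2_chain (Suc k) \<delta> = (\<exists>x. E x \<delta> \<and> limit2 x \<and> limit2_chain k x)"

text \<open>\<open>passed k \<delta>\<close> says that at least \<open>k + 1\<close> limits of limits are \<open>\<le> \<delta>\<close>. Including \<open>\<delta>\<close> itself
  makes the stages half-open intervals without a last element.\<close>

definition passed :: "nat \<Rightarrow> 'a \<Rightarrow> bool" where
  "passed k \<delta> \<longleftrightarrow> limit2_chain (Suc k) \<delta> \<or> limit2 \<delta> \<and> limit2_chain k \<delta>"

lemma wd_chain: "i < n \<Longrightarrow> wd n (\<lambda>w s. limit2_chain k (s i))"
proof (induction k arbitrary: i n)
  case (Suc k)
  then show ?case unfolding limit2_chain.simps by (intro wd_rules wd_limit2 Suc.IH; simp)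
qed (simp add: wd_basic)

lemma wd_chain_world: "wd n (\<lambda>w s. limit2_chain k w)"
proof (cases k)
  case (Suc k)
  then show ?thesis
    unfolding Suc limit2_chain.simps by (intro wd_rules wd_limit2 wd_chain; simp)
qed (simp add: wd_basic)

lemma wd_passed: "wd n (\<lambda>w s. passed k w)"
  unfolding passed_def by (intro wd_rules wd_limit2_world wd_chain_world)

lemma chain_mono: "Ord \<delta> \<Longrightarrow> E \<gamma> \<delta> \<Longrightarrow> limit2_chain k \<gamma> \<Longrightarrow> limit2_chain k \<delta>"
  using Ord_trans[of \<delta> \<gamma>] by (cases k) (simp, simp, blast)

lemma chain_Suc: "Ord \<delta> \<Longrightarrow> limit2_chain (Suc k) \<delta> \<Longrightarrow> limit2_chain k \<delta>"
  unfolding limit2_chain.simps using chain_mono by blast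

lemma passed_mono: "Ord \<delta> \<Longrightarrow> E \<gamma> \<delta> \<Longrightarrow> passed k \<gamma> \<Longrightarrow> passed k \<delta>"
  unfolding passed_def using chain_mono[of \<delta> \<gamma> "Suc k"] by auto

text \<open>Strictly between \<delta> and the next limit of limits, nothing new is counted.\<close>

lemma passed_same_stage:
  assumes "Ord \<mu>" "\<forall>x. E x \<mu> \<and> limit2 x \<longrightarrow> E x \<delta> \<or> x = \<delta>" "E \<xi> \<mu>" "E \<delta> \<xi>"
  shows "passed k \<xi> = passed k \<delta>"
proof
  have \<xi>: "Ord \<xi>" using Ord_in assms(1,3) .
  show "passed k \<xi>" if "passed k \<delta>" using passed_mono[OF \<xi> assms(4) that] .
  assume "passed k \<xi>"
  moreover have "\<not> limit2 \<xi>" using assms(2,3,4) E_asym E_irrefl by blast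
  ultimately obtain x where "E x \<xi>" "limit2 x" "limit2_chain k x" by (auto simp: passed_def)
  moreover from this have "E x \<delta> \<or> x = \<delta>" using assms(2) Ord_trans[OF assms(1,3)] by blast
  ultimately show "passed k \<delta>" by (auto simp: passed_def)
qed

text \<open>Below the next limit of limits there is a limit above \<delta>, and j successors of it
  still stay below.\<close>

lemma reach_offset:
  assumes \<delta>: "Ord \<delta>"
  shows "\<exists>\<xi>. Ord \<xi> \<and> E \<delta> \<xi> \<and> offset j \<xi> \<and> (\<forall>k. passed k \<xi> = passed k \<delta>)"
proof -
  obtain \<mu> where \<mu>: "Ord \<mu>" "limit2 \<mu>" "E \<delta> \<mu>" "\<forall>x. E x \<mu> \<and> limit2 x \<longrightarrow> E x \<delta> \<or> x = \<delta>"
    using next_limit2[OF \<delta>] by blast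
  have "\<exists>\<xi>. E \<xi> \<mu> \<and> E \<delta> \<xi> \<and> offset j \<xi>"
  proof (induction j)
    case 0
    obtain y where y: "E y \<mu>" "E \<delta> y" "limit y"
      using \<mu>(2,3) unfolding limit2_def limit_of_def by blast
    then have "offset 0 y" by (auto simp: limit_def limit_of_def)
    then show ?case using y by blast
  next
    case (Suc j)
    then obtain \<xi> where \<xi>: "E \<xi> \<mu>" "E \<delta> \<xi>" "offset j \<xi>" by blast
    \<comment> \<open>A limit of limits has no last element; the successor of \<xi> is at most this
      y.\<close>
    obtain y where y: "E y \<mu>" "E \<xi> y" using \<mu>(2) \<xi>(1) unfolding limit2_def limit_of_def by blast
    have Oy: "Ord y" using Ord_in \<mu>(1) y(1) .
    have "E (sc \<xi>) y \<or> sc \<xi> = y"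
      using Ord_trans[OF Oy y(2)] y(2)
      by (intro Ord_subset[OF Ord_sc[OF Ord_in[OF Oy y(2)]] Oy]) (auto simp: E_ins)
    then have "E (sc \<xi>) \<mu>" using y(1) Ord_trans[OF \<mu>(1) y(1)] by blast
    moreover have "offset (Suc j) (sc \<xi>)" using \<xi>(3) by (auto simp: E_ins)
    moreover have "E \<delta> (sc \<xi>)" using \<xi>(2) by (simp add: E_ins)
    ultimately show ?case by blast
  qed
  then obtain \<xi> where \<xi>: "E \<xi> \<mu>" "E \<delta> \<xi>" "offset j \<xi>" by blast
  then show ?thesis using passed_same_stage[OF \<mu>(1,4)] Ord_in[OF \<mu>(1)] by blast
qed

text \<open>The next limit of limits works: it counts itself and, beyond that, only what \<delta>
  has already passed.\<close>

lemma reach_passed: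
  assumes \<delta>: "Ord \<delta>" and below: "\<And>i. i < k \<Longrightarrow> passed i \<delta>" and now: "\<not> passed k \<delta>"
  shows "\<exists>\<xi>. Ord \<xi> \<and> E \<delta> \<xi> \<and> passed k \<xi> \<and> \<not> passed (Suc k) \<xi>"
proof -
  obtain \<mu> where \<mu>: "Ord \<mu>" "limit2 \<mu>" "E \<delta> \<mu>" "\<forall>x. E x \<mu> \<and> limit2 x \<longrightarrow> E x \<delta> \<or> x = \<delta>"
    using next_limit2[OF \<delta>] by blast
  have "limit2_chain k \<mu>"
  proof (cases k)
    case (Suc i)
    then have "limit2_chain (Suc i) \<delta> \<or> limit2 \<delta> \<and> limit2_chain i \<delta>"
      using below by (simp add: passed_def)
    then show ?thesis using chain_mono[OF \<mu>(1,3), of "Suc i"] \<mu>(3) Suc by auto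
  qed simp
  then have "passed k \<mu>" using \<mu>(2) by (simp add: passed_def)
  moreover have False if "passed (Suc k) \<mu>"
  proof -
    have "limit2_chain (Suc k) \<mu>"
      using that chain_Suc[OF \<mu>(1), of "Suc k"] unfolding passed_def by blast
    then obtain x where "E x \<mu>" "limit2 x" "limit2_chain k x" by auto
    then have "passed k \<delta>" using \<mu>(4) unfolding passed_def by auto
    then show False using now by blast
  qed
  ultimately show ?thesis using \<mu>(1,3) by blast
qed

definition stage :: "nat \<Rightarrow> 'a \<Rightarrow> nat" where
  "stage n \<delta> = (LEAST k. k = n \<or> \<not> passed k \<delta>)"

text \<open>The default \<open>N\<close> also covers ordinals at a nonstandard distance from the
  last limit, which satisfy no \<open>offset j\<close>.\<close>

definition dial :: "nat \<Rightarrow> 'a \<Rightarrow> nat" where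
  "dial N \<delta> = (LEAST j. j = N \<or> offset j \<delta>)"

lemma stage_eq: "stage n \<delta> = i \<longleftrightarrow> i \<le> n \<and> (i = n \<or> \<not> passed i \<delta>) \<and> (\<forall>k<i. passed k \<delta>)"
  unfolding stage_def Least_capped by simp

lemma dial_eq: "dial N \<delta> = j \<longleftrightarrow> j \<le> N \<and> (j = N \<or> offset j \<delta>) \<and> (\<forall>k<j. \<not> offset k \<delta>)"
  unfolding dial_def Least_capped by simp

lemma stage_le: "stage n \<delta> \<le> n" and dial_le: "dial N \<delta> \<le> N"
  using stage_eq[of n \<delta> "stage n \<delta>"] dial_eq[of N \<delta> "dial N \<delta>"] by auto

lemma stage_mono: "Ord \<delta> \<Longrightarrow> E \<gamma> \<delta> \<Longrightarrow> stage n \<gamma> \<le> stage n \<delta>"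
  using stage_eq[of n \<gamma> "stage n \<gamma>"] stage_eq[of n \<delta> "stage n \<delta>"] passed_mono[of \<delta> \<gamma>]
  by (metis not_less)

lemma dial_offset: "offset j \<delta> \<Longrightarrow> j \<le> N \<Longrightarrow> dial N \<delta> = j"
  unfolding dial_eq using offset_unique by blast

text \<open>Stages are climbed one at a time, so none is skipped.\<close>

lemma reach_stage:
  assumes "Ord \<delta>" "stage n \<delta> + d \<le> n"
  shows "\<exists>\<xi>. Ord \<xi> \<and> (E \<delta> \<xi> \<or> \<delta> = \<xi>) \<and> stage n \<xi> = stage n \<delta> + d"
  using assms(2)
proof (induction d)
  case 0
  then show ?case using assms(1) by auto
next
  case (Suc d)
  then obtain \<xi> where \<xi>: "Ord \<xi>" "E \<delta> \<xi> \<or> \<delta> = \<xi>" "stage n \<xi> = stage n \<delta> + d" by auto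
  let ?i = "stage n \<delta> + d"
  have i: "\<forall>k<?i. passed k \<xi>" "\<not> passed ?i \<xi>" using \<xi>(3) Suc.prems by (auto simp: stage_eq)
  then obtain \<zeta> where \<zeta>: "Ord \<zeta>" "E \<xi> \<zeta>" "passed ?i \<zeta>" "\<not> passed (Suc ?i) \<zeta>"
    using reach_passed[OF \<xi>(1)] by blast
  have "stage n \<zeta> = Suc ?i"
    unfolding stage_eq using \<zeta>(3,4) Suc.prems i(1) passed_mono[OF \<zeta>(1,2)] by (auto simp: less_Suc_eq)
  moreover have "E \<delta> \<zeta>" using \<xi>(2) \<zeta>(1,2) Ord_trans by blast
  ultimately show ?case using \<zeta>(1) by auto
qed

text \<open>The stage is set first: adjusting the dial keeps the stage, whereas entering a new stage
  resets the dial.\<close>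

lemma reach_stage_dial:
  assumes \<delta>: "Ord \<delta>" and "stage n \<delta> \<le> i" "i \<le> n" "j \<le> N"
  shows "\<exists>\<xi>. Ord \<xi> \<and> E \<delta> \<xi> \<and> stage n \<xi> = i \<and> dial N \<xi> = j"
proof -
  obtain \<zeta> where \<zeta>: "Ord \<zeta>" "E \<delta> \<zeta> \<or> \<delta> = \<zeta>" "stage n \<zeta> = i"
    using reach_stage[OF \<delta>, of n "i - stage n \<delta>"] assms(2,3) by auto
  obtain \<xi> where \<xi>: "Ord \<xi>" "E \<zeta> \<xi>" "offset j \<xi>" "\<forall>k. passed k \<xi> = passed k \<zeta>"
    using reach_offset[OF \<zeta>(1)] by blast
  have "stage n \<xi> = i" using \<zeta>(3) \<xi>(4) by (simp add: stage_def)
  moreover have "E \<delta> \<xi>" using \<zeta>(2) \<xi>(1,2) Ord_trans by blast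
  ultimately show ?thesis using \<xi>(1) dial_offset[OF \<xi>(3) assms(4)] by blast
qed

text \<open>\<open>U\<close> is an arbitrary external predicate; only finitely many labels exist, so
  a finite disjunction expresses it.\<close>

lemma stage_dial_sentence:
  "\<exists>\<phi>. \<phi> \<in> L_set \<and> (\<forall>R w s. Ord w \<longrightarrow> sat E (Vseg E) R w s \<phi> = U (stage n w) (dial N w))"
proof -
  have stage: "wd 0 (\<lambda>w s. stage n w = i)" for i
    unfolding stage_eq wd_def
    by (intro defin_conj defin_disj defin_all_less defin_const defin_not
        wd_passed[unfolded wd_def])
  have dial: "wd 0 (\<lambda>w s. dial N w = j)" for j
    unfolding dial_eq wd_def
    by (intro defin_conj defin_disj defin_all_less defin_const defin_not
        wd_offset_world[unfolded wd_def])
  have "wd 0 (\<lambda>w s. \<exists>i\<le>n. \<exists>j\<le>N. U i j \<and> stage n w = i \<and> dial N w = j)"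
    using stage dial unfolding wd_def by (intro defin_ex_le defin_conj defin_const)
  then have "wd 0 (\<lambda>w s. U (stage n w) (dial N w))"
    by (rule wd_cong) (use stage_le dial_le in auto)
  then show ?thesis by (auto simp: wd_def defin_def L_set_def)
qed

section \<open>Soundness and completeness for the ranks\<close>

lemma Val_rank_sound:
  assumes "Ord \<beta>" "p \<in> S43"
  shows "p \<in> Val_rank E \<beta> L"
  unfolding Val_def mem_Collect_eq sat_inst
proof (intro allI impI)
  fix \<sigma> :: "nat \<Rightarrow> 'a fml" and s :: "nat \<Rightarrow> 'a"
  show "holds (ord_le E) (\<lambda>v n. sat E (Vseg E) (ord_le E) v s (\<sigma> n)) \<beta> p"
  proof (rule S43_sound[OF assms(2), where A = "{\<beta>. Ord \<beta>}"])
    show "ord_le E u w" if "ord_le E u v" "ord_le E v w" for u v w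
      using that Ord_trans unfolding ord_le_def by blast
    show "ord_le E v w \<or> ord_le E w v" if "v \<in> {\<beta>. Ord \<beta>}" "w \<in> {\<beta>. Ord \<beta>}" for v w
      using that Ord_linear[of v w] unfolding ord_le_def by auto
  qed (use assms in \<open>auto simp: ord_le_def\<close>)
qed

lemma Val_rank_complete:
  assumes empty: "\<And>x. \<not> E x \<beta>" and val: "p \<in> Val_rank E \<beta> L_set"
  shows "p \<in> S43"
proof (rule ccontr)
  assume "p \<notin> S43"
  then obtain n N V where
    ref: "\<not> holds (\<lambda>(i, j) (i', j'). i \<le> i' \<and> i' \<le> n \<and> j' \<le> N) V (0::nat, 0::nat) p"
    using S43_complete by blast
  \<comment> \<open>Each propositional variable becomes a sentence that reads its truth value off
    the label of the world.\<close>
  have "\<exists>\<sigma>. \<forall>m. \<sigma> m \<in> L_set \<and>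
      (\<forall>R w s. Ord w \<longrightarrow> sat E (Vseg E) R w s (\<sigma> m) = V (stage n w, dial N w) m)"
    using stage_dial_sentence[where U = "\<lambda>i j. V (i, j) _"]
    by (intro Hilbert_Choice.choice allI)
  then obtain \<sigma> where \<sigma>: "\<And>m. \<sigma> m \<in> L_set"
      "\<And>R w s m. Ord w \<Longrightarrow> sat E (Vseg E) R w s (\<sigma> m) = V (stage n w, dial N w) m"
    by blast
  have \<beta>: "Ord \<beta>" using empty by (simp add: is_Ord_def is_trans_def)
  have "limit2 \<beta> \<Longrightarrow> False" using empty by (simp add: limit2_def limit_of_def)
  then have "(stage n \<beta>, dial N \<beta>) = (0, 0)"
    using empty by (auto simp: stage_eq dial_eq passed_def)
  moreover have "holds (ord_le E) (\<lambda>v m. sat E (Vseg E) (ord_le E) v (\<lambda>_. \<beta>) (\<sigma> m)) \<beta> p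
      = holds (\<lambda>(i, j) (i', j'). i \<le> i' \<and> i' \<le> n \<and> j' \<le> N) V (stage n \<beta>, dial N \<beta>) p"
  proof (rule holds_bounded_morphism[where A = "{\<beta>. Ord \<beta>}" and g = "\<lambda>w. (stage n w, dial N w)"],
      goal_cases)
    case (3 w v)
    then show ?case using stage_mono stage_le dial_le by (auto simp: ord_le_def)
  next
    case (4 w u)
    then show ?case
      using reach_stage_dial[of w n "fst u" "snd u" N] by (cases u) (auto simp: ord_le_def)
  qed (auto simp: \<beta> \<sigma>(2) ord_le_def)
  ultimately show False
    using val ref \<sigma>(1) unfolding Val_def mem_Collect_eq sat_inst by auto
qed

end

theorem theorem9:
  fixes E :: "'a \<Rightarrow> 'a \<Rightarrow> bool"
  assumes "ZFC E"
  shows "\<exists>\<beta>. is_Ord E \<beta> \<and>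
    S43 = Val_rank E \<beta> (L_set_dia (Vseg E \<beta>)) \<and>
    Val_rank E \<beta> (L_set_dia (Vseg E \<beta>)) = Val_rank E \<beta> L_set"
proof -
  interpret ZFC E by (rule assms)
  obtain \<beta> where empty: "\<And>x. \<not> E x \<beta>" using infinity by blast
  then have \<beta>: "is_Ord E \<beta>" by (simp add: is_Ord_def is_trans_def)
  have "S43 \<subseteq> Val_rank E \<beta> (L_set_dia (Vseg E \<beta>))"
    using Val_rank_sound[OF \<beta>] by blast
  \<comment> \<open>A smaller language has fewer instances and so validates at least as
    much.\<close>
  moreover have "Val_rank E \<beta> (L_set_dia (Vseg E \<beta>)) \<subseteq> Val_rank E \<beta> L_set"
    by (auto simp: Val_def L_set_def L_set_dia_def)
  moreover have "Val_rank E \<beta> L_set \<subseteq> S43"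
    using Val_rank_complete[OF empty] by blast
  ultimately show ?thesis using \<beta> by blast
qed

end
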